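(* Let $k\ge 1$. If the word problem in $H_k$ (with respect to the generators $b_1,\dots,b_k$) is solvable, then the word problem in $G_{k+1}^{k}$ (with respect to the generators $b_1,\dots,b_{k+1}$) is solvable. Moreover, the solution of the latter is constructive once the solution of the former is constructive: from an algorithm solving the word problem in $H_k$ one can explicitly construct an algorithm solving the word problem in $G_{k+1}^{k}$.
   Context: The group $G_{k+1}^{k}$ is generated by elements $a_m$, one for each $k$-element subset $m\subset\{1,\dots,k+1\}$, with relations $a_m^2=1$ for every $m$, and $(a_{m^1}a_{m^2}\cdots a_{m^{k+1}})^2=1$ for every ordering $m^1,\dots,m^{k+1}$ of all the $k$-element subsets of $\{1,\dots,k+1\}$. The generators are renamed lexicographically as $b_1=a_{\{1,2,\dots,k\}},\dots,b_{k+1}=a_{\{2,3,\dots,k+1\}}$. $H_k$ is the subgroup of $G_{k+1}^{k}$ consisting of all elements that can be represented by words with no occurrence of the last letter $b_{k+1}$, i.e. the subgroup generated by $b_1,\dots,b_k$. *)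

theory Defs
  imports "HOL-Algebra.Generated_Groups" "HOL-Library.Nat_Bijection"
begin

section \<open>Partial recursive functions\<close>

text \<open>
  Algorithms are programs for Kleene's partial recursive functions. They act on argument lists;
  a program applied to a list of unsuitable length simply has no value.
\<close>

datatype recf =
    Zero
  | Succ
  | Proj nat
  | Comp recf "recf list"
  | PrimRec recf recf
  | Mu recf

inductive computes :: "recf \<Rightarrow> nat list \<Rightarrow> nat \<Rightarrow> bool" where
  Zero: "computes Zero xs 0"
| Succ: "computes Succ [x] (Suc x)"
| Proj: "i < length xs \<Longrightarrow> computes (Proj i) xs (xs ! i)"
| Comp: "list_all2 (\<lambda>g y. computes g xs y) gs ys \<Longrightarrow> computes f ys z \<Longrightarrow> computes (Comp f gs) xs z"
| PrimRec_0: "computes f xs y \<Longrightarrow> computes (PrimRec f g) (0 # xs) y"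
| PrimRec_Suc: "computes (PrimRec f g) (n # xs) r \<Longrightarrow> computes g (n # r # xs) y
    \<Longrightarrow> computes (PrimRec f g) (Suc n # xs) y"
| Mu: "computes f (n # xs) 0 \<Longrightarrow> (\<forall>m<n. \<exists>y. computes f (m # xs) (Suc y))
    \<Longrightarrow> computes (Mu f) xs n"

text \<open>A Goedel numbering, by which programs can be inputs and outputs of programs.\<close>

primrec recf_code :: "recf \<Rightarrow> nat" where
  "recf_code Zero = prod_encode (0, 0)"
| "recf_code Succ = prod_encode (1, 0)"
| "recf_code (Proj i) = prod_encode (2, i)"
| "recf_code (Comp f gs) = prod_encode (3, prod_encode (recf_code f, list_encode (map recf_code gs)))"
| "recf_code (PrimRec f g) = prod_encode (4, prod_encode (recf_code f, recf_code g))"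
| "recf_code (Mu f) = prod_encode (5, recf_code f)"


section \<open>Groups given by generators and relations\<close>

text \<open>In a group word the letter \<open>(x, False)\<close> stands for \<open>x\<close> and \<open>(x, True)\<close> for its formal inverse.\<close>

type_synonym 'a gword = "('a \<times> bool) list"

definition gwords :: "'a set \<Rightarrow> 'a gword set" where
  "gwords S = lists (S \<times> UNIV)"

inductive_set word_rel :: "'a set \<Rightarrow> 'a gword set \<Rightarrow> ('a gword \<times> 'a gword) set"
  for S :: "'a set" and R :: "'a gword set" where
  refl: "u \<in> gwords S \<Longrightarrow> (u, u) \<in> word_rel S R"
| sym: "(u, v) \<in> word_rel S R \<Longrightarrow> (v, u) \<in> word_rel S R"
| trans: "(u, v) \<in> word_rel S R \<Longrightarrow> (v, w) \<in> word_rel S R \<Longrightarrow> (u, w) \<in> word_rel S R"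
| cancel: "u \<in> gwords S \<Longrightarrow> v \<in> gwords S \<Longrightarrow> x \<in> S
    \<Longrightarrow> (u @ [(x, e), (x, \<not> e)] @ v, u @ v) \<in> word_rel S R"
| relator: "u \<in> gwords S \<Longrightarrow> v \<in> gwords S \<Longrightarrow> r \<in> R \<Longrightarrow> r \<in> gwords S
    \<Longrightarrow> (u @ r @ v, u @ v) \<in> word_rel S R"

definition presented_group :: "'a set \<Rightarrow> 'a gword set \<Rightarrow> 'a gword set monoid" where
  "presented_group S R =
    \<lparr>carrier = gwords S // word_rel S R,
     mult = (\<lambda>A B. \<Union>u\<in>A. \<Union>v\<in>B. word_rel S R `` {u @ v}),
     one = word_rel S R `` {[]}\<rparr>"

definition gen_class :: "'a set \<Rightarrow> 'a gword set \<Rightarrow> 'a \<Rightarrow> 'a gword set" where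
  "gen_class S R x = word_rel S R `` {[(x, False)]}"

lemma word_rel_gwords: "(u, v) \<in> word_rel S R \<Longrightarrow> u \<in> gwords S \<and> v \<in> gwords S"
  by (induction rule: word_rel.induct) (auto simp: gwords_def)

lemma equiv_word_rel: "equiv (gwords S) (word_rel S R)"
proof (rule equivI)
  show "word_rel S R \<subseteq> gwords S \<times> gwords S"
    by (auto dest: word_rel_gwords)
  show "refl_on (gwords S) (word_rel S R)"
    by (rule refl_onI) (rule word_rel.refl)
  show "sym (word_rel S R)"
    by (rule symI) (rule word_rel.sym)
  show "trans (word_rel S R)"
    by (rule transI) (rule word_rel.trans)
qed

lemma word_rel_context:
  "(u, v) \<in> word_rel S R \<Longrightarrow> x \<in> gwords S \<Longrightarrow> y \<in> gwords S \<Longrightarrow> (x @ u @ y, x @ v @ y) \<in> word_rel S R"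
proof (induction rule: word_rel.induct)
  case (refl u)
  then show ?case
    by (intro word_rel.refl) (auto simp: gwords_def)
next
  case (sym u v)
  show ?case by (rule word_rel.sym[OF sym.IH[OF sym.prems]])
next
  case (trans u v w)
  show ?case
    by (rule word_rel.trans[OF trans.IH(1)[OF trans.prems] trans.IH(2)[OF trans.prems]])
next
  case (cancel u v a e)
  then show ?case
    using word_rel.cancel[of "x @ u" S "v @ y" a e R] by (auto simp: gwords_def)
next
  case (relator u v r)
  then show ?case
    using word_rel.relator[of "x @ u" S "v @ y" r R] by (auto simp: gwords_def)
qed

lemma word_rel_append:
  assumes "(u, u') \<in> word_rel S R" "(v, v') \<in> word_rel S R"
  shows "(u @ v, u' @ v') \<in> word_rel S R"
proof -
  have "(u @ v, u' @ v) \<in> word_rel S R"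
    using word_rel_context[OF assms(1), of "[]" v] word_rel_gwords[OF assms(2)]
    by (auto simp: gwords_def)
  moreover have "(u' @ v, u' @ v') \<in> word_rel S R"
    using word_rel_context[OF assms(2), of u' "[]"] word_rel_gwords[OF assms(1)]
    by (auto simp: gwords_def)
  ultimately show ?thesis by (rule word_rel.trans)
qed

lemma presented_group_mult:
  assumes "u \<in> gwords S" "v \<in> gwords S"
  shows "word_rel S R `` {u} \<otimes>\<^bsub>presented_group S R\<^esub> word_rel S R `` {v} = word_rel S R `` {u @ v}"
proof -
  have "word_rel S R `` {u' @ v'} = word_rel S R `` {u @ v}"
    if "(u, u') \<in> word_rel S R" "(v, v') \<in> word_rel S R" for u' v'
    using equiv_class_eq[OF equiv_word_rel word_rel_append[OF that]] by simp
  then have "(\<Union>u'\<in>word_rel S R `` {u}. \<Union>v'\<in>word_rel S R `` {v}. word_rel S R `` {u' @ v'})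
      = (\<Union>u'\<in>word_rel S R `` {u}. \<Union>v'\<in>word_rel S R `` {v}. word_rel S R `` {u @ v})"
    by (intro SUP_cong) (simp_all only: Image_singleton_iff)
  moreover have "u \<in> word_rel S R `` {u}" "v \<in> word_rel S R `` {v}"
    using assms by (simp_all add: word_rel.refl)
  then have "word_rel S R `` {u} \<noteq> {}" "word_rel S R `` {v} \<noteq> {}"
    by blast+
  ultimately show ?thesis
    by (simp add: presented_group_def)
qed

lemma word_rel_inverse:
  "u \<in> gwords S \<Longrightarrow> (rev (map (\<lambda>(x, e). (x, \<not> e)) u) @ u, []) \<in> word_rel S R"
proof (induction u)
  case Nil
  then show ?case using word_rel.refl[of "[]" S R] by simp
next
  case (Cons l u)
  obtain x e where l: "l = (x, e)" by (cases l)
  let ?i = "rev (map (\<lambda>(x, e). (x, \<not> e)) u)"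
  have u: "u \<in> gwords S" "x \<in> S" "?i \<in> gwords S"
    using Cons.prems l by (auto simp: gwords_def)
  have "(?i @ [(x, \<not> e), (x, \<not> \<not> e)] @ u, ?i @ u) \<in> word_rel S R"
    using u by (intro word_rel.cancel)
  then have "(?i @ [(x, \<not> e), (x, \<not> \<not> e)] @ u, []) \<in> word_rel S R"
    using Cons.IH[OF u(1)] by (rule word_rel.trans)
  then show ?case using l by simp
qed

lemma group_presented_group: "group (presented_group S R)"
proof (rule groupI)
  let ?G = "presented_group S R"
  have carr: "carrier ?G = gwords S // word_rel S R" and one: "\<one>\<^bsub>?G\<^esub> = word_rel S R `` {[]}"
    by (simp_all add: presented_group_def)
  have nil: "[] \<in> gwords S" by (simp add: gwords_def)
  have app: "u \<in> gwords S \<Longrightarrow> v \<in> gwords S \<Longrightarrow> u @ v \<in> gwords S" for u v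
    by (simp add: gwords_def)
  show "\<one>\<^bsub>?G\<^esub> \<in> carrier ?G"
    unfolding carr one using nil by (rule quotientI)
  fix A B assume A: "A \<in> carrier ?G" and B: "B \<in> carrier ?G"
  obtain u where u: "u \<in> gwords S" "A = word_rel S R `` {u}"
    using A unfolding carr by (rule quotientE)
  obtain v where v: "v \<in> gwords S" "B = word_rel S R `` {v}"
    using B unfolding carr by (rule quotientE)
  show "A \<otimes>\<^bsub>?G\<^esub> B \<in> carrier ?G"
    using u v app by (simp add: presented_group_mult carr quotientI)
  fix C assume C: "C \<in> carrier ?G"
  obtain w where w: "w \<in> gwords S" "C = word_rel S R `` {w}"
    using C unfolding carr by (rule quotientE)
  show "A \<otimes>\<^bsub>?G\<^esub> B \<otimes>\<^bsub>?G\<^esub> C = A \<otimes>\<^bsub>?G\<^esub> (B \<otimes>\<^bsub>?G\<^esub> C)"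
    using u v w app by (simp add: presented_group_mult)
next
  let ?G = "presented_group S R"
  fix A assume "A \<in> carrier ?G"
  then obtain u where u: "u \<in> gwords S" "A = word_rel S R `` {u}"
    unfolding presented_group_def by (auto elim: quotientE)
  have nil: "[] \<in> gwords S" by (simp add: gwords_def)
  show "\<one>\<^bsub>?G\<^esub> \<otimes>\<^bsub>?G\<^esub> A = A"
    using presented_group_mult[OF nil u(1), of R] u(2) by (simp add: presented_group_def)
  let ?i = "rev (map (\<lambda>(x, e). (x, \<not> e)) u)"
  have i: "?i \<in> gwords S" using u(1) by (auto simp: gwords_def)
  have "word_rel S R `` {?i} \<otimes>\<^bsub>?G\<^esub> A = \<one>\<^bsub>?G\<^esub>"
    using presented_group_mult[OF i u(1), of R] u(2)
      equiv_class_eq[OF equiv_word_rel word_rel_inverse[OF u(1), of R]]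
    by (simp add: presented_group_def)
  moreover have "word_rel S R `` {?i} \<in> carrier ?G"
    using i by (simp add: presented_group_def quotientI)
  ultimately show "\<exists>B\<in>carrier ?G. B \<otimes>\<^bsub>?G\<^esub> A = \<one>\<^bsub>?G\<^esub>" by blast
qed


section \<open>The word problem\<close>

definition word_value :: "('a, 'm) monoid_scheme \<Rightarrow> (nat \<Rightarrow> 'a) \<Rightarrow> nat gword \<Rightarrow> 'a" where
  "word_value G g w =
    foldr (\<lambda>(i, e) a. (if e then inv\<^bsub>G\<^esub> (g i) else g i) \<otimes>\<^bsub>G\<^esub> a) w \<one>\<^bsub>G\<^esub>"

definition gword_code :: "nat gword \<Rightarrow> nat" where
  "gword_code w = list_encode (map (\<lambda>(i, e). prod_encode (i, of_bool e)) w)"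

text \<open>
  The program \<open>p\<close> solves the word problem of \<open>G\<close> with respect to the generators
  \<open>g 1, \<dots>, g n\<close>: it halts on every group word in these generators and outputs 1 or 0
  according to whether the word represents the neutral element.
\<close>

definition solves_word_problem ::
  "recf \<Rightarrow> ('a, 'm) monoid_scheme \<Rightarrow> (nat \<Rightarrow> 'a) \<Rightarrow> nat \<Rightarrow> bool" where
  "solves_word_problem p G g n \<longleftrightarrow>
    (\<forall>w \<in> gwords {1..n}. computes p [gword_code w] (if word_value G g w = \<one>\<^bsub>G\<^esub> then 1 else 0))"

definition word_problem_solvable ::
  "('a, 'm) monoid_scheme \<Rightarrow> (nat \<Rightarrow> 'a) \<Rightarrow> nat \<Rightarrow> bool" where
  "word_problem_solvable G g n \<longleftrightarrow> (\<exists>p. solves_word_problem p G g n)"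


section \<open>The groups $G_{k+1}^k$ and their subgroups $H_k$\<close>

definition k_subsets :: "nat \<Rightarrow> nat set set" where
  "k_subsets k = {m. m \<subseteq> {1..k+1} \<and> card m = k}"

definition G_relators :: "nat \<Rightarrow> nat set gword set" where
  "G_relators k =
    {[(m, False), (m, False)] | m. m \<in> k_subsets k} \<union>
    {map (\<lambda>m. (m, False)) (ms @ ms) | ms. distinct ms \<and> set ms = k_subsets k}"

definition G_group :: "nat \<Rightarrow> nat set gword set monoid" where
  "G_group k = presented_group (k_subsets k) (G_relators k)"

definition a_gen :: "nat \<Rightarrow> nat set \<Rightarrow> nat set gword set" where
  "a_gen k m = gen_class (k_subsets k) (G_relators k) m"

text \<open>
  In lexicographic order, the \<open>j\<close>-th of the \<open>k\<close>-element subsets of \<open>{1, \<dots>, k + 1}\<close>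
  is the one that omits \<open>k + 2 - j\<close>, for \<open>1 \<le> j \<le> k + 1\<close>.
\<close>

definition b_gen :: "nat \<Rightarrow> nat \<Rightarrow> nat set gword set" where
  "b_gen k j = a_gen k ({1..k+1} - {k + 2 - j})"

definition H_group :: "nat \<Rightarrow> nat set gword set monoid" where
  "H_group k = (G_group k)\<lparr>carrier := generate (G_group k) (b_gen k ` {1..k})\<rparr>"

end

theory Submission
  imports Defs
begin

text \<open>
  Let \<open>b\<^sub>1, \<dots>, b\<^sub>k\<close> and \<open>c\<close> be the generators of the group \<open>G\<close>, where \<open>c\<close> is the last one. A cyclic
  rotation brings a long relator into the form \<open>c T c T\<close>, where \<open>T\<close> is a product of
  \<open>b\<^sub>1, \<dots>, b\<^sub>k\<close> in some order. So these relators say that conjugation by \<open>c\<close> inverts every such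
  product \<open>T\<close>. Let \<open>N\<close> be the subgroup generated by these products. It lies in the subgroup
  \<open>H\<close> generated by \<open>b\<^sub>1, \<dots>, b\<^sub>k\<close>, and two observations make the word problem easy to transfer.

  First, a word \<open>h\<close> in \<open>b\<^sub>1, \<dots>, b\<^sub>k\<close> represents an element of \<open>N\<close> if and only if the numbers of
  occurrences of \<open>b\<^sub>1, \<dots>, b\<^sub>k\<close> in \<open>h\<close> are all even or all odd. In that case \<open>c h c\<close> equals a word
  in \<open>b\<^sub>1, \<dots>, b\<^sub>k\<close> which is computed by pushing \<open>c\<close> through \<open>h\<close> letter by letter
  (\<open>push_identity\<close>, \<open>val_conj_word\<close>). Replacing factors \<open>c h c\<close> of this kind as long as
  possible turns a word into \<open>h\<^sub>0 c h\<^sub>1 c \<dots> c h\<^sub>n\<close> with \<open>h\<^sub>1, \<dots>, h\<^sub>n\<^sub>-\<^sub>1\<close> not in \<open>N\<close>; a stack of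
  words does this in one pass.

  Second, \<open>N\<close> is normal in \<open>G\<close>, and the quotient is the free product of \<open>H/N\<close>, an elementary
  abelian 2-group described by parities, and the group of order two generated by \<open>c\<close>. If
  \<open>n \<ge> 1\<close>, the image of \<open>h\<^sub>0 c h\<^sub>1 c \<dots> c h\<^sub>n\<close> in the free product is a reduced word of positive
  length, so the word is not trivial in \<open>G\<close>. Formally, \<open>G\<close> acts on the reduced words of the
  free product, encoded as stacks of parity classes (\<open>val_act\<close>), and the stack of words maps
  to the stack of classes at each step (\<open>parity_stack_step\<close>).

  Hence a word in all the generators is trivial in \<open>G\<close> if and only if \<open>n = 0\<close> and \<open>h\<^sub>0\<close> is trivial
  in \<open>H\<close>. This is a many-one reduction (\<open>reduce_correct\<close>), uniform in \<open>k\<close>. Being a functional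
  program built from folds over lists, it is recursive (\<open>computable_reduce\<close>). Composing it with a program \<open>p\<close>
  for \<open>H\<close> gives a program for \<open>G\<close>, whose code is a computable function of \<open>k\<close> and the code of
  \<open>p\<close> (\<open>uniform_reduction\<close>).
\<close>

section \<open>Total recursive functions on the natural numbers\<close>

text \<open>
  Argument lists of length \<open>n\<close> serve as environments: the variables of a function are the
  projections \<open>xs ! i\<close>, so that one composition rule per number of arguments builds
  programs for all nested expressions.
\<close>

definition rec_fn :: "nat \<Rightarrow> (nat list \<Rightarrow> nat) \<Rightarrow> bool" where
  "rec_fn n F \<longleftrightarrow> (\<exists>r. \<forall>xs. length xs = n \<longrightarrow> computes r xs (F xs))"

abbreviation rec1 :: "(nat \<Rightarrow> nat) \<Rightarrow> bool" where
  "rec1 f \<equiv> rec_fn 1 (\<lambda>xs. f (xs ! 0))"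

abbreviation rec2 :: "(nat \<Rightarrow> nat \<Rightarrow> nat) \<Rightarrow> bool" where
  "rec2 f \<equiv> rec_fn 2 (\<lambda>xs. f (xs ! 0) (xs ! 1))"

abbreviation rec3 :: "(nat \<Rightarrow> nat \<Rightarrow> nat \<Rightarrow> nat) \<Rightarrow> bool" where
  "rec3 f \<equiv> rec_fn 3 (\<lambda>xs. f (xs ! 0) (xs ! 1) (xs ! 2))"

lemma rec_fn_proj: "i < n \<Longrightarrow> rec_fn n (\<lambda>xs. xs ! i)"
  unfolding rec_fn_def by (metis computes.Proj)

lemma rec1_comp:
  assumes "rec1 f" "rec_fn n g"
  shows "rec_fn n (\<lambda>xs. f (g xs))"
proof -
  obtain p where p: "computes p xs (f (xs ! 0))" if "length xs = 1" for xs
    using assms(1) unfolding rec_fn_def by blast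
  obtain q where q: "computes q xs (g xs)" if "length xs = n" for xs
    using assms(2) unfolding rec_fn_def by blast
  have "computes (Comp p [q]) xs (f (g xs))" if "length xs = n" for xs
    using computes.Comp[of xs "[q]" "[g xs]" p] q[OF that] p[of "[g xs]"] by simp
  then show ?thesis unfolding rec_fn_def by blast
qed

lemma rec2_comp:
  assumes "rec2 f" "rec_fn n g" "rec_fn n h"
  shows "rec_fn n (\<lambda>xs. f (g xs) (h xs))"
proof -
  obtain p where p: "computes p xs (f (xs ! 0) (xs ! 1))" if "length xs = 2" for xs
    using assms(1) unfolding rec_fn_def by blast
  obtain q where q: "computes q xs (g xs)" if "length xs = n" for xs
    using assms(2) unfolding rec_fn_def by blast
  obtain r where r: "computes r xs (h xs)" if "length xs = n" for xs
    using assms(3) unfolding rec_fn_def by blast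
  have "computes (Comp p [q, r]) xs (f (g xs) (h xs))" if "length xs = n" for xs
    using computes.Comp[of xs "[q, r]" "[g xs, h xs]" p] q[OF that] r[OF that]
      p[of "[g xs, h xs]"] by simp
  then show ?thesis unfolding rec_fn_def by blast
qed

lemma rec3_comp:
  assumes "rec3 f" "rec_fn n g" "rec_fn n h" "rec_fn n l"
  shows "rec_fn n (\<lambda>xs. f (g xs) (h xs) (l xs))"
proof -
  obtain p where p: "computes p xs (f (xs ! 0) (xs ! 1) (xs ! 2))" if "length xs = 3" for xs
    using assms(1) unfolding rec_fn_def by blast
  obtain q where q: "computes q xs (g xs)" if "length xs = n" for xs
    using assms(2) unfolding rec_fn_def by blast
  obtain r where r: "computes r xs (h xs)" if "length xs = n" for xs
    using assms(3) unfolding rec_fn_def by blast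
  obtain s where s: "computes s xs (l xs)" if "length xs = n" for xs
    using assms(4) unfolding rec_fn_def by blast
  have "computes (Comp p [q, r, s]) xs (f (g xs) (h xs) (l xs))" if "length xs = n" for xs
    using computes.Comp[of xs "[q, r, s]" "[g xs, h xs, l xs]" p] q[OF that] r[OF that] s[OF that]
      p[of "[g xs, h xs, l xs]"] by simp
  then show ?thesis unfolding rec_fn_def by blast
qed

lemma rec1_Suc: "rec1 Suc"
proof -
  have "computes Succ xs (Suc (xs ! 0))" if "length xs = 1" for xs
    using that computes.Succ by (cases xs) auto
  then show ?thesis unfolding rec_fn_def by blast
qed

lemma rec_fn_const: "rec_fn n (\<lambda>_. c)"
proof (induction c)
  case 0
  show ?case unfolding rec_fn_def by (metis computes.Zero)
next
  case (Suc c)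
  show ?case by (rule rec1_comp[OF rec1_Suc Suc])
qed

text \<open>
  One parameter \<open>x\<close> suffices, as several parameters can be paired.
\<close>

lemma rec2_prim_rec:
  assumes "rec1 a" "rec3 s"
  shows "rec2 (\<lambda>m x. rec_nat (a x) (\<lambda>i r. s i r x) m)"
proof -
  obtain p where p: "computes p xs (a (xs ! 0))" if "length xs = 1" for xs
    using assms(1) unfolding rec_fn_def by blast
  obtain q where q: "computes q xs (s (xs ! 0) (xs ! 1) (xs ! 2))" if "length xs = 3" for xs
    using assms(2) unfolding rec_fn_def by blast
  have "computes (PrimRec p q) [m, x] (rec_nat (a x) (\<lambda>i r. s i r x) m)" for m x
  proof (induction m)
    case 0
    show ?case using p[of "[x]"] by (auto intro: computes.PrimRec_0)
  next
    case (Suc m)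
    show ?case
      using q[of "[m, rec_nat (a x) (\<lambda>i r. s i r x) m, x]"]
      by (auto intro: computes.PrimRec_Suc[OF Suc])
  qed
  then have "computes (PrimRec p q) xs (rec_nat (a (xs ! 1)) (\<lambda>i r. s i r (xs ! 1)) (xs ! 0))"
    if "length xs = 2" for xs
    using that by (auto simp: length_Suc_conv numeral_2_eq_2)
  then show ?thesis unfolding rec_fn_def by blast
qed

lemmas rec_intros = rec_fn_proj rec_fn_const rec1_comp[OF rec1_Suc]

lemma rec2_add: "rec2 (+)"
proof -
  have "rec2 (\<lambda>m x. rec_nat x (\<lambda>i r. Suc r) m)"
    by (rule rec2_prim_rec) (rule rec_intros | simp)+
  moreover have "rec_nat x (\<lambda>i r. Suc r) m = m + x" for m x :: nat
    by (induction m) auto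
  ultimately show ?thesis by simp
qed

lemma rec1_pred: "rec1 (\<lambda>x. x - 1)"
proof -
  have *: "rec2 (\<lambda>m x. rec_nat 0 (\<lambda>i r. i) m)"
    by (rule rec2_prim_rec) (rule rec_intros | simp)+
  have "rec1 (\<lambda>x. rec_nat 0 (\<lambda>i r. i) x)"
    by (rule rec2_comp[OF *]) (rule rec_intros | simp)+
  moreover have "rec_nat 0 (\<lambda>i r. i) m = m - 1" for m :: nat
    by (cases m) auto
  ultimately show ?thesis by simp
qed

lemma rec2_diff: "rec2 (-)"
proof -
  have *: "rec2 (\<lambda>m x. rec_nat x (\<lambda>i r. r - 1) m)"
    by (rule rec2_prim_rec) (rule rec_intros rec1_comp[OF rec1_pred] | simp)+
  have "rec2 (\<lambda>x m. rec_nat x (\<lambda>i r. r - 1) m)"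
    by (rule rec2_comp[OF *]) (rule rec_intros | simp)+
  moreover have "rec_nat x (\<lambda>i r. r - 1) m = x - m" for m x :: nat
    by (induction m) auto
  ultimately show ?thesis by simp
qed

lemma rec1_triangle: "rec1 triangle"
proof -
  have *: "rec2 (\<lambda>m x. rec_nat 0 (\<lambda>i r. r + Suc i) m)"
    by (rule rec2_prim_rec) (rule rec_intros rec2_comp[OF rec2_add] | simp)+
  have "rec1 (\<lambda>x. rec_nat 0 (\<lambda>i r. r + Suc i) x)"
    by (rule rec2_comp[OF *]) (rule rec_intros | simp)+
  moreover have "rec_nat 0 (\<lambda>i r. r + Suc i) m = triangle m" for m :: nat
    by (induction m) auto
  ultimately show ?thesis by simp
qed

lemma rec2_pair: "rec2 (\<lambda>x y. prod_encode (x, y))"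
  unfolding prod_encode_def prod.case
  by (rule rec_intros rec2_comp[OF rec2_add] rec1_comp[OF rec1_triangle] | simp)+

text \<open>
  A pair lies on the diagonal whose index is the sum of its components; the index for the
  code \<open>Suc n\<close> exceeds the one for \<open>n\<close> exactly if \<open>Suc n\<close> is a triangle number.
\<close>

primrec diagonal :: "nat \<Rightarrow> nat" where
  "diagonal 0 = 0"
| "diagonal (Suc n) =
    diagonal n + (1 - (triangle (Suc (diagonal n)) - Suc n))"

lemma triangle_mono: "m \<le> n \<Longrightarrow> triangle m \<le> triangle n"
  by (induction rule: dec_induct) auto

lemma diagonal_bounds: "triangle (diagonal n) \<le> n \<and> n < triangle (Suc (diagonal n))"
proof (induction n)
  case (Suc n)
  show ?case
  proof (cases "triangle (Suc (diagonal n)) \<le> Suc n")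
    case True
    then have "diagonal (Suc n) = Suc (diagonal n)" by simp
    moreover have "triangle (Suc (diagonal n)) = Suc n" using True Suc by simp
    ultimately show ?thesis by simp
  next
    case False
    then have "diagonal (Suc n) = diagonal n" by simp
    then show ?thesis using False Suc by simp
  qed
qed simp

lemma diagonal_prod_encode: "diagonal (prod_encode (a, b)) = a + b"
proof -
  let ?n = "prod_encode (a, b)"
  have "triangle (a + b) \<le> ?n" "?n < triangle (Suc (a + b))"
    by (auto simp: prod_encode_def)
  moreover have "triangle (diagonal ?n) \<le> ?n" "?n < triangle (Suc (diagonal ?n))"
    using diagonal_bounds by auto
  moreover have "triangle (Suc i) \<le> triangle j" if "i < j" for i j
    using that by (intro triangle_mono) simp
  ultimately show ?thesis
    by (meson leD le_less_trans less_le_trans linorder_neqE_nat)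
qed

lemma rec1_diagonal: "rec1 diagonal"
proof -
  have *: "rec2 (\<lambda>m x. rec_nat 0 (\<lambda>i r. r + (1 - (triangle (Suc r) - Suc i))) m)"
    by (rule rec2_prim_rec)
      (rule rec_intros rec2_comp[OF rec2_add] rec2_comp[OF rec2_diff]
        rec1_comp[OF rec1_triangle] | simp del: triangle_Suc)+
  have "rec1 (\<lambda>x. rec_nat 0 (\<lambda>i r. r + (1 - (triangle (Suc r) - Suc i))) x)"
    by (rule rec2_comp[OF *]) (rule rec_intros | simp)+
  moreover have "rec_nat 0 (\<lambda>i r. r + (1 - (triangle (Suc r) - Suc i))) m = diagonal m" for m :: nat
    by (induction m) (auto simp del: triangle_Suc)
  ultimately show ?thesis by simp
qed

lemma rec1_fst: "rec1 (\<lambda>n. fst (prod_decode n))"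
proof -
  have "fst (prod_decode n) = n - triangle (diagonal n)" for n
  proof -
    obtain a b where "n = prod_encode (a, b)"
      by (metis prod_decode_inverse prod.exhaust)
    then show ?thesis
      by (simp add: diagonal_prod_encode) (simp add: prod_encode_def)
  qed
  then show ?thesis
    by simp (rule rec_intros rec2_comp[OF rec2_diff] rec1_comp[OF rec1_triangle]
      rec1_comp[OF rec1_diagonal] | simp)+
qed

lemma rec1_snd: "rec1 (\<lambda>n. snd (prod_decode n))"
proof -
  have "snd (prod_decode n) = diagonal n - fst (prod_decode n)" for n
    using diagonal_prod_encode[of "fst (prod_decode n)" "snd (prod_decode n)"] by simp
  then show ?thesis
    by simp (rule rec_intros rec2_comp[OF rec2_diff] rec1_comp[OF rec1_fst]
      rec1_comp[OF rec1_diagonal] | simp)+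
qed

text \<open>
  A branch is a recursion that ignores its recursive results; the two alternatives are paired
  to fit into the single parameter.
\<close>

lemma rec3_if_zero: "rec3 (\<lambda>c a b. if c = 0 then a else b)"
proof -
  have *: "rec2 (\<lambda>m x. rec_nat (fst (prod_decode x)) (\<lambda>i r. snd (prod_decode x)) m)"
    by (rule rec2_prim_rec)
      (rule rec_intros rec1_comp[OF rec1_fst] rec1_comp[OF rec1_snd] | simp)+
  have "rec3 (\<lambda>c a b. rec_nat (fst (prod_decode (prod_encode (a, b))))
      (\<lambda>i r. snd (prod_decode (prod_encode (a, b)))) c)"
    by (rule rec2_comp[OF *]) (rule rec_intros rec2_comp[OF rec2_pair] | simp)+
  moreover have "rec_nat a (\<lambda>i r. b) c = (if c = 0 then a else b)" for a b c :: nat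
    by (cases c) auto
  ultimately show ?thesis by (simp del: One_nat_def)
qed

section \<open>Computable functions on encoded data\<close>

text \<open>
  The encodings extend \<open>gword_code\<close> to nested data, so that the reduction below can be
  written as a functional program on lists and pairs.
\<close>

class encodable =
  fixes enc :: "'a \<Rightarrow> nat"

instantiation nat :: encodable
begin
definition enc_nat :: "nat \<Rightarrow> nat" where "enc_nat n = n"
instance ..
end

instantiation bool :: encodable
begin
definition enc_bool :: "bool \<Rightarrow> nat" where "enc_bool b = of_bool b"
instance ..
end

instantiation prod :: (encodable, encodable) encodable
begin
definition enc_prod :: "'a \<times> 'b \<Rightarrow> nat" where "enc_prod x = prod_encode (enc (fst x), enc (snd x))"
instance ..
end

instantiation list :: (encodable) encodable
begin
definition enc_list :: "'a list \<Rightarrow> nat" where "enc_list xs = list_encode (map enc xs)"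
instance ..
end

lemma enc_simps [simp]:
  "enc (n :: nat) = n"
  "enc b = of_bool b"
  "enc (x, y) = prod_encode (enc x, enc y)"
  "enc [] = 0"
  "enc (x # xs) = Suc (prod_encode (enc x, enc xs))"
  by (simp_all add: enc_nat_def enc_bool_def enc_prod_def enc_list_def)

lemma gword_code_eq_enc: "gword_code w = enc w"
  by (auto simp: gword_code_def enc_list_def intro!: arg_cong[where f = list_encode])

text \<open>
  The function \<open>F\<close> is total and recursive on all natural numbers, including those that
  encode nothing. A program for a branch may therefore evaluate both alternatives. The closure
  rules that follow are introduction rules, with which automation compiles functional programs.
\<close>

definition computable :: "('a::encodable \<Rightarrow> 'b::encodable) \<Rightarrow> bool" where
  "computable f \<longleftrightarrow> (\<exists>F. rec1 F \<and> (\<forall>x. F (enc x) = enc (f x)))"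

lemma computableI: "rec1 F \<Longrightarrow> (\<And>x. F (enc x) = enc (f x)) \<Longrightarrow> computable f"
  unfolding computable_def by blast

lemma computable_id [intro!]: "computable (\<lambda>x. x)"
  by (rule computableI[of "\<lambda>x. x"]) (auto intro: rec_fn_proj)

lemma computable_const [intro!]: "computable (\<lambda>x. c)"
  by (rule computableI[of "\<lambda>x. enc c"]) (auto intro: rec_fn_const)

lemma computable_comp:
  assumes "computable f" "computable g"
  shows "computable (\<lambda>x. f (g x))"
proof -
  obtain F where F: "rec1 F" "\<And>x. F (enc x) = enc (f x)" using assms(1) unfolding computable_def by blast
  obtain G where G: "rec1 G" "\<And>x. G (enc x) = enc (g x)" using assms(2) unfolding computable_def by blast
  show ?thesis
    by (rule computableI[of "\<lambda>x. F (G x)"]) (use F G rec1_comp in auto)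
qed

lemma computable_Pair [intro!]:
  assumes "computable f" "computable g"
  shows "computable (\<lambda>x. (f x, g x))"
proof -
  obtain F where F: "rec1 F" "\<And>x. F (enc x) = enc (f x)" using assms(1) unfolding computable_def by blast
  obtain G where G: "rec1 G" "\<And>x. G (enc x) = enc (g x)" using assms(2) unfolding computable_def by blast
  show ?thesis
    by (rule computableI[of "\<lambda>x. prod_encode (F x, G x)"]) (use F G rec2_comp[OF rec2_pair] in auto)
qed

lemma computable_fst [intro!]: "computable f \<Longrightarrow> computable (\<lambda>x. fst (f x))"
  by (rule computable_comp[of fst]) (rule computableI[OF rec1_fst], auto)

lemma computable_snd [intro!]: "computable f \<Longrightarrow> computable (\<lambda>x. snd (f x))"
  by (rule computable_comp[of snd]) (rule computableI[OF rec1_snd], auto)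

lemma computable_Suc [intro!]: "computable f \<Longrightarrow> computable (\<lambda>x. Suc (f x))"
  by (rule computable_comp[of Suc]) (rule computableI[OF rec1_Suc], auto)

lemma computable_Cons [intro!]:
  assumes "computable f" "computable g"
  shows "computable (\<lambda>x. f x # g x)"
proof -
  have "computable (\<lambda>p. fst p # snd p)"
    by (rule computableI[OF rec1_Suc]) auto
  from computable_comp[OF this computable_Pair[OF assms]] show ?thesis by simp
qed

lemma computable_prod_encode [intro!]:
  assumes "computable f" "computable g"
  shows "computable (\<lambda>x. prod_encode (f x, g x))"
proof -
  have "computable (\<lambda>p. prod_encode p)"
    by (rule computableI[of "\<lambda>x. x"]) (auto intro: rec_fn_proj)
  from computable_comp[OF this computable_Pair[OF assms]] show ?thesis by simp
qed

lemma computable_eq [intro!]: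
  fixes f g :: "'a::encodable \<Rightarrow> nat"
  assumes "computable f" "computable g"
  shows "computable (\<lambda>x. f x = g x)"
proof -
  have "rec1 (\<lambda>n. 1 - ((fst (prod_decode n) - snd (prod_decode n))
      + (snd (prod_decode n) - fst (prod_decode n))))"
    by (rule rec_intros rec2_comp[OF rec2_add] rec2_comp[OF rec2_diff]
        rec1_comp[OF rec1_fst] rec1_comp[OF rec1_snd] | simp)+
  then have "computable (\<lambda>p :: nat \<times> nat. fst p = snd p)"
    by (rule computableI) auto
  from computable_comp[OF this computable_Pair[OF assms]] show ?thesis by simp
qed

lemma computable_if [intro!]:
  assumes "computable b" "computable f" "computable g"
  shows "computable (\<lambda>x. if b x then f x else g x)"
proof -
  obtain B where B: "rec1 B" "\<And>x. B (enc x) = enc (b x)" using assms(1) unfolding computable_def by blast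
  obtain F where F: "rec1 F" "\<And>x. F (enc x) = enc (f x)" using assms(2) unfolding computable_def by blast
  obtain G where G: "rec1 G" "\<And>x. G (enc x) = enc (g x)" using assms(3) unfolding computable_def by blast
  show ?thesis
    by (rule computableI[OF rec3_comp[OF rec3_if_zero B(1) G(1) F(1)]]) (use B F G in auto)
qed

lemma computable_not [intro!]: "computable b \<Longrightarrow> computable (\<lambda>x. \<not> b x)"
  using computable_if[of b "\<lambda>_. False" "\<lambda>_. True"]
  by (simp add: computable_const if_bool_eq_conj)

lemma computable_disj [intro!]:
  "computable a \<Longrightarrow> computable b \<Longrightarrow> computable (\<lambda>x. a x \<or> b x)"
  using computable_if[of a "\<lambda>_. True" b] by (simp add: computable_const disj_imp if_bool_eq_conj)

lemma computable_case_list [intro!]: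
  assumes "computable l" "computable f" "computable (\<lambda>(x, y, ys). g x y ys)"
  shows "computable (\<lambda>x. case l x of [] \<Rightarrow> f x | y # ys \<Rightarrow> g x y ys)"
proof -
  obtain L where L: "rec1 L" "\<And>x. L (enc x) = enc (l x)" using assms(1) unfolding computable_def by blast
  obtain F where F: "rec1 F" "\<And>x. F (enc x) = enc (f x)" using assms(2) unfolding computable_def by blast
  obtain G where G: "rec1 G" "\<And>z. G (enc z) = enc ((\<lambda>(x, y, ys). g x y ys) z)"
    using assms(3) unfolding computable_def by blast
  have "rec1 (\<lambda>n. if L n = 0 then F n else G (prod_encode (n, L n - 1)))"
    by (rule rec3_comp[OF rec3_if_zero L(1) F(1)])
      (rule rec1_comp[OF G(1)] rec2_comp[OF rec2_pair] rec1_comp[OF rec1_pred] rec_intros L(1) | simp)+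
  then show ?thesis
  proof (rule computableI)
    fix x
    show "(if L (enc x) = 0 then F (enc x) else G (prod_encode (enc x, L (enc x) - 1)))
        = enc (case l x of [] \<Rightarrow> f x | y # ys \<Rightarrow> g x y ys)"
      using L F G(2)[of "(x, y, ys)" for y ys] by (auto split: list.split)
  qed
qed

lemma computable_rec_nat [intro!]:
  assumes "computable k" "computable a" "computable (\<lambda>(x, i, r). s x i r)"
  shows "computable (\<lambda>x. rec_nat (a x) (s x) (k x))"
proof -
  obtain K where K: "rec1 K" "\<And>x. K (enc x) = enc (k x)" using assms(1) unfolding computable_def by blast
  obtain F where F: "rec1 F" "\<And>x. F (enc x) = enc (a x)" using assms(2) unfolding computable_def by blast
  obtain S where S: "rec1 S" "\<And>z. S (enc z) = enc ((\<lambda>(x, i, r). s x i r) z)"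
    using assms(3) unfolding computable_def by blast
  have *: "rec2 (\<lambda>m x. rec_nat (F x) (\<lambda>i r. S (prod_encode (x, prod_encode (i, r)))) m)"
    by (rule rec2_prim_rec[OF F(1)])
      (rule rec1_comp[OF S(1)] rec2_comp[OF rec2_pair] rec_intros | simp)+
  have "rec1 (\<lambda>n. rec_nat (F n) (\<lambda>i r. S (prod_encode (n, prod_encode (i, r)))) (K n))"
    by (rule rec2_comp[OF * K(1)]) (rule rec_intros | simp)+
  moreover have "rec_nat (F (enc x)) (\<lambda>i r. S (prod_encode (enc x, prod_encode (i, r)))) m
      = enc (rec_nat (a x) (s x) m)" for x m
    using F S(2)[of "(x, i, r)" for i r] by (induction m) auto
  ultimately show ?thesis
    using K by (intro computableI) auto
qed

lemma length_le_enc: "length xs \<le> enc xs"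
proof (induction xs)
  case (Cons x xs)
  then show ?case using le_prod_encode_2[of "enc xs" "enc x"] by simp
qed simp

text \<open>
  A list is consumed by a counted loop. Its code bounds its length, so the code serves as
  the number of rounds, and idle rounds do no harm.
\<close>

lemma computable_fold [intro!]:
  fixes l :: "'a::encodable \<Rightarrow> 'b::encodable list"
  assumes "computable l" "computable a" "computable (\<lambda>(x, y, r). s x y r)"
  shows "computable (\<lambda>x. fold (s x) (l x) (a x))"
proof -
  define loop where "loop = (\<lambda>x. rec_nat (l x, a x)
    (\<lambda>i st. case fst st of [] \<Rightarrow> st | y # ys \<Rightarrow> (ys, s x y (snd st))))"
  have step: "computable (\<lambda>p. s (f p) (g p) (h p))"
    if "computable f" "computable g" "computable h" for f g h
    using computable_comp[OF assms(3) computable_Pair[OF that(1) computable_Pair[OF that(2,3)]]]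
    by simp
  have size: "computable (\<lambda>x. enc (l x))"
    using assms(1) unfolding computable_def by auto
  have "computable (\<lambda>x. snd (loop x (enc (l x))))"
    unfolding loop_def case_prod_unfold
    by (intro computable_rec_nat computable_snd computable_Pair assms size)
      (auto simp: case_prod_unfold intro!: step)
  moreover have "snd (rec_nat (ys, r) (\<lambda>i st. case fst st of [] \<Rightarrow> st | y # ys \<Rightarrow> (ys, s x y (snd st))) m)
      = fold (s x) ys r" if "length ys \<le> m" for ys r m x
  proof -
    have "rec_nat (ys, r) (\<lambda>i st. case fst st of [] \<Rightarrow> st | y # ys \<Rightarrow> (ys, s x y (snd st))) m
        = (drop m ys, fold (s x) (take m ys) r)" for m
    proof (induction m)
      case (Suc m)
      show ?case
      proof (cases "m < length ys")
        case True
        then show ?thesis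
          using Suc by (simp add: Cons_nth_drop_Suc[symmetric] take_Suc_conv_app_nth)
      qed (use Suc in simp)
    qed simp
    then show ?thesis using that by simp
  qed
  ultimately show ?thesis
    unfolding loop_def by (simp add: length_le_enc)
qed

lemma computable_rev [intro!]: "computable f \<Longrightarrow> computable (\<lambda>x. rev (f x))"
  unfolding rev_conv_fold by (auto simp: case_prod_unfold)

lemma computable_append [intro!]:
  assumes "computable f" "computable g"
  shows "computable (\<lambda>x. f x @ g x)"
proof -
  have "f x @ g x = fold (#) (rev (f x)) (g x)" for x
    by (simp add: fold_Cons_rev)
  then show ?thesis using assms by (auto simp: case_prod_unfold)
qed

lemma computable_map [intro!]:
  assumes "computable l" "computable (\<lambda>(x, y). g x y)"
  shows "computable (\<lambda>x. map (g x) (l x))"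
proof -
  have "map (g x) ys = rev (fold (\<lambda>y r. g x y # r) ys [])" for x ys
  proof -
    have "fold (\<lambda>y r. g x y # r) ys zs = rev (map (g x) ys) @ zs" for zs
      by (induction ys arbitrary: zs) auto
    then show ?thesis by simp
  qed
  moreover have "computable (\<lambda>p. g (fst p) (fst (snd p)))"
    by (rule computable_comp[OF assms(2), of "\<lambda>p. (fst p, fst (snd p))", simplified]) auto
  ultimately show ?thesis using assms(1) by (auto simp: case_prod_unfold)
qed

lemma computable_filter [intro!]:
  assumes "computable l" "computable (\<lambda>(x, y). P x y)"
  shows "computable (\<lambda>x. filter (P x) (l x))"
proof -
  have "filter (P x) ys = rev (fold (\<lambda>y r. if P x y then y # r else r) ys [])" for x ys
  proof -
    have "fold (\<lambda>y r. if P x y then y # r else r) ys zs = rev (filter (P x) ys) @ zs" for zs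
      by (induction ys arbitrary: zs) auto
    then show ?thesis by simp
  qed
  moreover have "computable (\<lambda>p. P (fst p) (fst (snd p)))"
    by (rule computable_comp[OF assms(2), of "\<lambda>p. (fst p, fst (snd p))", simplified]) auto
  ultimately show ?thesis using assms(1) by (auto simp: case_prod_unfold)
qed

lemma computable_member [intro!]:
  fixes f :: "'a::encodable \<Rightarrow> nat"
  assumes "computable f" "computable l"
  shows "computable (\<lambda>x. f x \<in> set (l x))"
proof -
  have "fold (\<lambda>y r. r \<or> f x = y) ys b \<longleftrightarrow> b \<or> f x \<in> set ys" for x ys b
    by (induction ys arbitrary: b) auto
  then have "f x \<in> set (l x) \<longleftrightarrow> fold (\<lambda>y r. r \<or> f x = y) (l x) False" for x
    by simp
  moreover have "computable (\<lambda>p :: 'a \<times> nat \<times> bool. f (fst p))"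
    by (rule computable_comp[OF assms(1)]) auto
  ultimately show ?thesis using assms(2) by (auto simp: case_prod_unfold)
qed

lemma computable_upt [intro!]:
  assumes "computable k"
  shows "computable (\<lambda>x. [1..<Suc (k x)])"
proof -
  have "[1..<Suc n] = rec_nat [] (\<lambda>i r. r @ [Suc i]) n" for n
    by (induction n) auto
  then show ?thesis using assms by (auto simp: case_prod_unfold simp del: upt_Suc)
qed

lemma computable_null [intro!]: "computable l \<Longrightarrow> computable (\<lambda>x. l x = [])"
  using computable_case_list[of l "\<lambda>_. True" "\<lambda>_ _ _. False"]
  by (simp add: computable_const case_prod_unfold list.case_eq_if if_bool_eq_conj)

section \<open>Eliminating the last generator from words\<close>

text \<open>
  Write \<open>c\<close> for the generator with index \<open>k + 1\<close>. Pushing \<open>c\<close> from left to right through a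
  word \<open>h\<close> in the other generators yields a pair \<open>(P, T)\<close> with \<open>c h = P c T\<close>, where \<open>T\<close> lists
  without repetition the letters that occur an odd number of times in \<open>h\<close>. A letter \<open>b\<close>
  that is not in \<open>T\<close> is appended to \<open>T\<close>. For a letter \<open>b\<close> in \<open>T\<close>, let \<open>T'\<close> be \<open>T\<close> without
  \<open>b\<close>, and let \<open>V\<close> list the letters that are not in \<open>T\<close>. Then \<open>T V\<close> and \<open>T' b V\<close> are
  products of all the generators but \<open>c\<close>, so conjugation by \<open>c\<close> inverts them, and
  \<open>T b = (T V) W T'\<close>, where \<open>W\<close> is the inverse of \<open>T' b V\<close>. Hence \<open>c T b = Z c T'\<close>, where
  \<open>Z\<close> is the inverse of \<open>T V\<close> followed by \<open>T' b V\<close>.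
\<close>

definition missing :: "nat \<Rightarrow> nat list \<Rightarrow> nat list" where
  "missing k T = filter (\<lambda>i. i \<notin> set T) [1..<Suc k]"

definition push_step :: "nat \<Rightarrow> nat \<Rightarrow> nat list \<times> nat list \<Rightarrow> nat list \<times> nat list" where
  "push_step k b st =
    (if b \<in> set (snd st)
     then (fst st @ rev (missing k (snd st)) @ rev (snd st)
             @ filter (\<lambda>i. i \<noteq> b) (snd st) @ b # missing k (snd st),
           filter (\<lambda>i. i \<noteq> b) (snd st))
     else (fst st, snd st @ [b]))"

definition push :: "nat \<Rightarrow> nat list \<Rightarrow> nat list \<times> nat list" where
  "push k h = fold (push_step k) h ([], [])"

text \<open>
  If \<open>T\<close> is empty or lists all the letters, then \<open>c T c\<close> is the inverse of \<open>T\<close>, and thus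
  \<open>c h c\<close> equals \<open>P\<close> followed by the inverse of \<open>T\<close>, a word without \<open>c\<close>.
\<close>

definition balanced :: "nat \<Rightarrow> nat list \<Rightarrow> bool" where
  "balanced k h \<longleftrightarrow> snd (push k h) = [] \<or> missing k (snd (push k h)) = []"

definition conj_word :: "nat \<Rightarrow> nat list \<Rightarrow> nat list" where
  "conj_word k h = fst (push k h) @ rev (snd (push k h))"

text \<open>
  The stack \<open>[h\<^sub>n, \<dots>, h\<^sub>0]\<close> stands for the word \<open>h\<^sub>0 c h\<^sub>1 c \<dots> c h\<^sub>n\<close>. When a further \<open>c\<close> is
  read and \<open>h\<^sub>n\<close> is balanced, the factor \<open>c h\<^sub>n c\<close> is replaced and joins \<open>h\<^sub>n\<^sub>-\<^sub>1\<close>. The bottom of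
  the stack is not preceded by \<open>c\<close> and so is never replaced.
\<close>

definition stack_step :: "nat \<Rightarrow> nat \<Rightarrow> nat list list \<Rightarrow> nat list list" where
  "stack_step k j st = (case st of [] \<Rightarrow> [] | h # s \<Rightarrow>
     if j \<noteq> Suc k then (h @ [j]) # s
     else case s of [] \<Rightarrow> [[], h] | h' # s' \<Rightarrow>
       if balanced k h then (h' @ conj_word k h) # s' else [] # h # s)"

definition stack :: "nat \<Rightarrow> nat list \<Rightarrow> nat list list" where
  "stack k js = fold (stack_step k) js [[]]"

text \<open>
  If some \<open>c\<close> remains, the word is not trivial, and any nontrivial element of the subgroup can
  serve as its image; the first generator is one, by \<open>val_1_nontrivial\<close>. Signs of letters are
  ignored because all generators are involutions.
\<close>

definition reduce :: "nat \<Rightarrow> nat gword \<Rightarrow> nat gword" where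
  "reduce k w = (case stack k (map fst w) of [] \<Rightarrow> [(1, False)] | h # s \<Rightarrow>
     if s = [] then map (\<lambda>j. (j, False)) h else [(1, False)])"

lemma computable_missing [intro!]:
  "computable k \<Longrightarrow> computable T \<Longrightarrow> computable (\<lambda>x. missing (k x) (T x))"
  by (rule computable_comp[of "\<lambda>p. missing (fst p) (snd p)" "\<lambda>x. (k x, T x)", simplified])
    (auto simp: missing_def case_prod_unfold simp del: upt_Suc One_nat_def)

lemma computable_push [intro!]:
  "computable k \<Longrightarrow> computable h \<Longrightarrow> computable (\<lambda>x. push (k x) (h x))"
  by (rule computable_comp[of "\<lambda>p. push (fst p) (snd p)" "\<lambda>x. (k x, h x)", simplified])
    (auto simp: push_def push_step_def case_prod_unfold)

lemma computable_stack [intro!]: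
  "computable k \<Longrightarrow> computable js \<Longrightarrow> computable (\<lambda>x. stack (k x) (js x))"
  by (rule computable_comp[of "\<lambda>p. stack (fst p) (snd p)" "\<lambda>x. (k x, js x)", simplified])
    (auto simp: stack_def stack_step_def balanced_def conj_word_def case_prod_unfold)

lemma computable_reduce: "computable (\<lambda>p. reduce (fst p) (snd p))"
  by (auto simp: reduce_def case_prod_unfold)

section \<open>Composing a program with a reduction\<close>

primrec const_prog :: "nat \<Rightarrow> recf" where
  "const_prog 0 = Zero"
| "const_prog (Suc n) = Comp Succ [const_prog n]"

lemma computes_const_prog: "computes (const_prog n) xs n"
proof (induction n)
  case (Suc n)
  then show ?case
    using computes.Comp[of xs "[const_prog n]" "[n]" Succ "Suc n"] computes.Succ by simp
qed (simp add: computes.Zero)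

lemma computable_recf_code_const_prog [intro!]:
  "computable n \<Longrightarrow> computable (\<lambda>x. recf_code (const_prog (n x)))"
proof -
  have *: "recf_code (const_prog n) = rec_nat (recf_code Zero)
      (\<lambda>i r. prod_encode (3, prod_encode (recf_code Succ, Suc (prod_encode (r, 0))))) n" for n
    by (induction n) auto
  show "computable n \<Longrightarrow> ?thesis"
    unfolding * by (auto simp: case_prod_unfold)
qed

lemma computable2_program:
  fixes f :: "'a::encodable \<Rightarrow> 'b::encodable \<Rightarrow> 'c::encodable"
  assumes "computable (\<lambda>p. f (fst p) (snd p))"
  obtains r where "\<And>x y. computes r [enc x, enc y] (enc (f x y))"
proof -
  obtain F where F: "rec1 F" "\<And>p. F (enc p) = enc (f (fst p) (snd p))"
    using assms unfolding computable_def by blast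
  have "rec2 (\<lambda>a b. F (prod_encode (a, b)))"
    by (rule rec1_comp[OF F(1) rec2_pair])
  then obtain r where r: "\<And>xs. length xs = 2 \<Longrightarrow> computes r xs (F (prod_encode (xs ! 0, xs ! 1)))"
    unfolding rec_fn_def by blast
  have "computes r [enc x, enc y] (enc (f x y))" for x y
    using r[of "[enc x, enc y]"] F(2)[of "(x, y)"] by simp
  then show thesis by (rule that)
qed

text \<open>
  The composed program hardwires \<open>k\<close>, as a tower of successors, and contains the given program
  \<open>p\<close> as a subterm. Its code is therefore an arithmetic expression in the code of \<open>p\<close> and the
  code of that tower.
\<close>

lemma uniform_reduction:
  fixes f :: "nat \<Rightarrow> 'a::encodable \<Rightarrow> 'b::encodable"
  assumes "computable (\<lambda>p. f (fst p) (snd p))"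
  obtains c t where
    "\<And>k p. computes t [k, recf_code p] (recf_code (c k p))"
    "\<And>k p x z. computes p [enc (f k x)] z \<Longrightarrow> computes (c k p) [enc x] z"
proof -
  obtain r where r: "\<And>k x. computes r [k, enc x] (enc (f k x))"
    using computable2_program[OF assms] by auto
  define c where "c = (\<lambda>k p. Comp p [Comp r [const_prog k, Proj 0]])"
  have "computable (\<lambda>x :: nat \<times> nat. prod_encode (3, prod_encode (snd x, Suc (prod_encode
      (prod_encode (3, prod_encode (recf_code r, Suc (prod_encode (recf_code (const_prog (fst x)),
        Suc (prod_encode (recf_code (Proj 0), 0)))))), 0)))))"
    by auto
  then obtain t where "\<And>k a. computes t [k, a] (prod_encode (3, prod_encode (a, Suc (prod_encode
      (prod_encode (3, prod_encode (recf_code r, Suc (prod_encode (recf_code (const_prog k),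
        Suc (prod_encode (recf_code (Proj 0), 0)))))), 0)))))"
    by (elim computable2_program) auto
  then have "computes t [k, recf_code p] (recf_code (c k p))" for k p
    by (simp add: c_def)
  moreover have "computes (c k p) [enc x] z" if "computes p [enc (f k x)] z" for k p x z
  proof -
    have "computes (Proj 0) [enc x] (enc x)"
      using computes.Proj[of 0 "[enc x]"] by simp
    then have "computes (Comp r [const_prog k, Proj 0]) [enc x] (enc (f k x))"
      using computes.Comp[of "[enc x]" "[const_prog k, Proj 0]" "[k, enc x]" r] r
        computes_const_prog by simp
    then show ?thesis
      unfolding c_def
      using computes.Comp[of "[enc x]" "[Comp r [const_prog k, Proj 0]]" "[enc (f k x)]" p z] that
      by simp
  qed
  ultimately show thesis by (rule that)
qed

(* Generators are indexed from 1, and intervals that start at 1 should not be rewritten. *)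
declare One_nat_def [simp del]

section \<open>Invariants of presented groups\<close>

text \<open>
  This is the universal property of a presented group, for actions: letters that act as
  involutions, compatibly with the relators, make equivalent words act in the same way. It
  is the only means used below to tell group elements apart.
\<close>

lemma word_rel_fold_eq:
  assumes rel: "(u, v) \<in> word_rel S R"
    and closed: "\<And>x s. x \<in> S \<Longrightarrow> s \<in> X \<Longrightarrow> A x s \<in> X"
    and inv: "\<And>x s. x \<in> S \<Longrightarrow> s \<in> X \<Longrightarrow> A x (A x s) = s"
    and relator: "\<And>r s. r \<in> R \<Longrightarrow> s \<in> X \<Longrightarrow> fold A (map fst r) s = s"
    and s: "s \<in> X"
  shows "fold A (map fst u) s = fold A (map fst v) s"
proof -
  have X: "fold A (map fst u) s \<in> X" if "u \<in> gwords S" "s \<in> X" for u :: "'a gword" and s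
    using that by (induction u arbitrary: s) (auto simp: gwords_def closed)
  show ?thesis
    using rel s
  proof (induction arbitrary: s)
    case (cancel u v x e)
    then show ?case using X[OF cancel(1,4)] inv by simp
  next
    case (relator u v r)
    then show ?case using X[OF relator(1,5)] assms(4) by simp
  qed auto
qed

section \<open>An action on stacks of parity classes\<close>

text \<open>
  This set represents the vector of parities of the numbers of occurrences of the letters
  \<open>1, \<dots>, k\<close>, up to complementing the whole vector: comparison with the letter 1 picks a
  canonical representative. So the class is empty if and only if all the parities agree.
\<close>

definition parity_class :: "nat \<Rightarrow> nat list \<Rightarrow> nat set" where
  "parity_class k h = {i \<in> {1..k}. odd (count_list h i) \<noteq> odd (count_list h 1)}"

lemma parity_class_append:
  "parity_class k (u @ v) = sym_diff (parity_class k u) (parity_class k v)"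
  by (auto simp: parity_class_def)

lemma parity_class_rev [simp]: "parity_class k (rev u) = parity_class k u"
  by (simp add: parity_class_def)

lemma count_list_distinct: "distinct xs \<Longrightarrow> count_list xs x = of_bool (x \<in> set xs)"
  by (induction xs) auto

lemma parity_class_permutation:
  assumes "distinct h" "set h = {1..k}"
  shows "parity_class k h = {}"
proof -
  have "count_list h i = 1" if "i \<in> {1..k}" for i
    using assms that by (simp add: count_list_distinct)
  then show ?thesis by (auto simp: parity_class_def)
qed

text \<open>
  Reduced stacks of parity classes are the normal forms of the free product of the group of
  parity classes and the group of order two that \<open>c\<close> generates. The letters act by right multiplication.
  A stack \<open>[v\<^sub>n, \<dots>, v\<^sub>0]\<close> is reduced if none of \<open>v\<^sub>1, \<dots>, v\<^sub>n\<^sub>-\<^sub>1\<close>, which are enclosed by two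
  letters \<open>c\<close>, is trivial.
\<close>

definition act :: "nat \<Rightarrow> nat \<Rightarrow> nat set list \<Rightarrow> nat set list" where
  "act k j st = (case st of [] \<Rightarrow> [] | v # s \<Rightarrow>
     if j \<noteq> Suc k then sym_diff v (parity_class k [j]) # s
     else if v = {} \<and> s \<noteq> [] then s else {} # v # s)"

definition reduced_stacks :: "nat set list set" where
  "reduced_stacks = {st. st \<noteq> [] \<and> {} \<notin> set (butlast (tl st))}"

lemma act_reduced_stacks:
  assumes "st \<in> reduced_stacks"
  shows "act k j st \<in> reduced_stacks"
proof -
  obtain v s where st: "st = v # s" "{} \<notin> set (butlast s)"
    using assms by (cases st) (auto simp: reduced_stacks_def)
  show ?thesis
  proof (cases s)
    case Nil
    then show ?thesis using st by (simp add: reduced_stacks_def act_def)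
  next
    case (Cons v' s')
    then have "{} \<notin> set (butlast s')" using st(2) by (cases s') auto
    then show ?thesis using st Cons by (auto simp: reduced_stacks_def act_def)
  qed
qed

text \<open>
  For \<open>c\<close> this needs a reduced stack: after a pop the new top must not be popped in turn, which
  holds because it was enclosed, or else lies at the bottom.
\<close>

lemma act_act:
  assumes "st \<in> reduced_stacks"
  shows "act k j (act k j st) = st"
proof -
  obtain v s where st: "st = v # s" "{} \<notin> set (butlast s)"
    using assms by (cases st) (auto simp: reduced_stacks_def)
  consider "j \<noteq> Suc k" | "j = Suc k" "v = {}" "s \<noteq> []" | "j = Suc k" "v \<noteq> {} \<or> s = []"
    by blast
  then show ?thesis
  proof cases
    case 1
    have "sym_diff (sym_diff v x) x = v" for x by auto
    then show ?thesis using 1 by (simp add: act_def st)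
  next
    case 2
    then obtain v' s' where s: "s = v' # s'" by (cases s) auto
    then have "v' \<noteq> {} \<or> s' = []" using st(2) by (cases s') auto
    then show ?thesis using 2 by (auto simp: act_def st s)
  next
    case 3
    then show ?thesis by (auto simp: act_def st)
  qed
qed

lemma fold_act:
  assumes "Suc k \<notin> set u"
  shows "fold (act k) u (v # s) = sym_diff v (parity_class k u) # s"
  using assms
proof (induction u arbitrary: v)
  case Nil
  then show ?case by (simp add: parity_class_def)
next
  case (Cons j u)
  have "sym_diff (sym_diff v (parity_class k [j])) (parity_class k u)
      = sym_diff v (parity_class k (j # u))"
    using parity_class_append[of k "[j]" u] by auto
  then show ?case using Cons by (simp add: act_def)
qed

lemma fold_act_trivial:
  assumes "distinct u" "set u = {1..k}" "st \<noteq> []"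
  shows "fold (act k) u st = st"
proof -
  obtain v s where "st = v # s" using assms(3) by (cases st) auto
  moreover have "Suc k \<notin> set u" using assms(2) by simp
  ultimately show ?thesis
    using fold_act[of k u v s] parity_class_permutation[OF assms(1,2)] by simp
qed

text \<open>
  An ordering \<open>js\<close> of all letters is \<open>u c v\<close>, and both \<open>v u\<close> and \<open>u v\<close> contain each of the
  letters \<open>1, \<dots>, k\<close> once. Such words have the trivial parity class. In \<open>u c v u c v\<close> the
  factor \<open>v u\<close> thus has no effect, then \<open>c c\<close> cancels, and \<open>u v\<close> remains.
\<close>

lemma fold_act_relator:
  assumes "distinct js" "set js = {1..Suc k}" "st \<in> reduced_stacks"
  shows "fold (act k) (js @ js) st = st"
proof -
  obtain u v where js: "js = u @ Suc k # v"
    using split_list[of "Suc k" js] assms(2) by auto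
  have "distinct (u @ v)" "set (u @ v) = set js - {Suc k}"
    using assms(1) unfolding js by auto
  moreover have "set js - {Suc k} = {1..k}" unfolding assms(2) by auto
  ultimately have uv: "distinct (u @ v)" "set (u @ v) = {1..k}" by simp_all
  then have vu: "distinct (v @ u)" "set (v @ u) = {1..k}" by auto
  have ne: "act k (Suc k) st \<noteq> []" if "st \<in> reduced_stacks" for st
    using act_reduced_stacks[OF that] by (auto simp: reduced_stacks_def)
  have red: "fold (act k) w st \<in> reduced_stacks" for w
    by (induction w rule: rev_induct) (simp_all add: assms(3) act_reduced_stacks)
  let ?a = "fold (act k) u st"
  have "fold (act k) (js @ js) st
      = fold (act k) v (act k (Suc k) (fold (act k) (v @ u) (act k (Suc k) ?a)))"
    by (simp add: js)
  also have "\<dots> = fold (act k) v (act k (Suc k) (act k (Suc k) ?a))"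
    by (subst fold_act_trivial[OF vu ne[OF red]]) (rule HOL.refl)
  also have "\<dots> = fold (act k) (u @ v) st"
    using act_act[OF red[of u]] by simp
  also have "\<dots> = st"
    using assms(3) by (intro fold_act_trivial[OF uv]) (auto simp: reduced_stacks_def)
  finally show ?thesis .
qed

section \<open>Values of positive words\<close>

text \<open>
  The \<open>j\<close>-th of the \<open>k\<close>-element subsets of \<open>{1, \<dots>, k + 1}\<close> in lexicographic order.
\<close>

definition omit :: "nat \<Rightarrow> nat \<Rightarrow> nat set" where
  "omit k j = {1..k + 1} - {k + 2 - j}"

lemma bij_betw_omit: "bij_betw (omit k) {1..Suc k} (k_subsets k)"
proof (rule bij_betw_imageI)
  show "inj_on (omit k) {1..Suc k}"
  proof (rule inj_onI)
    fix i j assume ij: "i \<in> {1..Suc k}" "j \<in> {1..Suc k}" and eq: "omit k i = omit k j"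
    have "{1..k + 1} - omit k n = {k + 2 - n}" if "n \<in> {1..Suc k}" for n
      using that by (auto simp: omit_def)
    from this[OF ij(1)] this[OF ij(2)] have "k + 2 - i = k + 2 - j" using eq by simp
    then show "i = j" using ij by (simp; arith)
  qed
  show "omit k ` {1..Suc k} = k_subsets k"
  proof (intro equalityI subsetI)
    fix m assume "m \<in> omit k ` {1..Suc k}"
    then show "m \<in> k_subsets k" by (auto simp: omit_def k_subsets_def card_Diff_singleton_if)
  next
    fix m assume "m \<in> k_subsets k"
    then have m: "m \<subseteq> {1..k + 1}" "card m = k" by (auto simp: k_subsets_def)
    then have "card ({1..k + 1} - m) = 1"
      by (simp add: card_Diff_subset finite_subset)
    then obtain x where x: "{1..k + 1} - m = {x}" by (rule card_1_singletonE)
    then have "x \<in> {1..k + 1}" "m = {1..k + 1} - {x}" using m(1) by auto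
    then show "m \<in> omit k ` {1..Suc k}"
      by (intro image_eqI[of _ _ "k + 2 - x"]) (auto simp: omit_def)
  qed
qed

definition val :: "nat \<Rightarrow> nat list \<Rightarrow> nat set gword set" where
  "val k js = foldr (\<lambda>j a. b_gen k j \<otimes>\<^bsub>G_group k\<^esub> a) js \<one>\<^bsub>G_group k\<^esub>"

abbreviation pos_word :: "nat \<Rightarrow> nat list \<Rightarrow> nat set gword" where
  "pos_word k js \<equiv> map (\<lambda>j. (omit k j, False)) js"

lemma b_gen_omit: "b_gen k j = gen_class (k_subsets k) (G_relators k) (omit k j)"
  by (simp only: b_gen_def a_gen_def omit_def)

lemma group_G: "group (G_group k)"
  unfolding G_group_def by (rule group_presented_group)

lemma pos_word_gwords: "set js \<subseteq> {1..Suc k} \<Longrightarrow> pos_word k js \<in> gwords (k_subsets k)"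
  using bij_betw_apply[OF bij_betw_omit[of k]] by (auto simp: gwords_def subset_iff)

lemma val_eq_class:
  "set js \<subseteq> {1..Suc k} \<Longrightarrow> val k js = word_rel (k_subsets k) (G_relators k) `` {pos_word k js}"
proof (induction js)
  case Nil
  show ?case by (simp add: val_def G_group_def presented_group_def)
next
  case (Cons j js)
  have "b_gen k j \<otimes>\<^bsub>G_group k\<^esub> val k js
      = word_rel (k_subsets k) (G_relators k) `` {pos_word k [j] @ pos_word k js}"
    using Cons pos_word_gwords[of "[j]" k] pos_word_gwords[of js k]
    by (simp add: b_gen_omit gen_class_def G_group_def presented_group_mult)
  then show ?case by (simp add: val_def)
qed

lemma val_eq_iff:
  assumes "set u \<subseteq> {1..Suc k}" "set v \<subseteq> {1..Suc k}"
  shows "val k u = val k v \<longleftrightarrow> (pos_word k u, pos_word k v) \<in> word_rel (k_subsets k) (G_relators k)"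
  using assms by (simp add: val_eq_class eq_equiv_class_iff[OF equiv_word_rel] pos_word_gwords)

lemma val_closed: "set js \<subseteq> {1..Suc k} \<Longrightarrow> val k js \<in> carrier (G_group k)"
  by (simp add: val_eq_class G_group_def presented_group_def quotientI pos_word_gwords)

lemma val_Nil [simp]: "val k [] = \<one>\<^bsub>G_group k\<^esub>"
  by (simp add: val_def)

lemma val_append:
  assumes "set u \<subseteq> {1..Suc k}" "set v \<subseteq> {1..Suc k}"
  shows "val k (u @ v) = val k u \<otimes>\<^bsub>G_group k\<^esub> val k v"
  using assms
  by (simp add: val_eq_class presented_group_mult[OF pos_word_gwords pos_word_gwords] G_group_def)

lemma val_relator:
  assumes "r = pos_word k js" "r \<in> G_relators k" "set js \<subseteq> {1..Suc k}"
  shows "val k js = \<one>\<^bsub>G_group k\<^esub>"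
proof -
  have "(r, []) \<in> word_rel (k_subsets k) (G_relators k)"
    using word_rel.relator[of "[]" "k_subsets k" "[]" r] assms pos_word_gwords[of js k]
    by (simp add: gwords_def)
  then show ?thesis
    using assms val_eq_iff[of js k "[]"] by simp
qed

lemma val_square:
  assumes "j \<in> {1..Suc k}"
  shows "val k [j, j] = \<one>\<^bsub>G_group k\<^esub>"
  by (rule val_relator[OF HOL.refl])
    (use assms bij_betw_omit[of k] in \<open>auto simp: G_relators_def bij_betw_def\<close>)

lemma val_permutation_square:
  assumes "distinct js" "set js = {1..Suc k}"
  shows "val k (js @ js) = \<one>\<^bsub>G_group k\<^esub>"
proof (rule val_relator[OF HOL.refl])
  have "distinct (map (omit k) js)" "set (map (omit k) js) = k_subsets k"
    using assms bij_betw_omit[of k] by (auto simp: distinct_map bij_betw_def)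
  moreover have "pos_word k (js @ js) = map (\<lambda>m. (m, False)) (map (omit k) js @ map (omit k) js)"
    by simp
  ultimately show "pos_word k (js @ js) \<in> G_relators k"
    unfolding G_relators_def by blast
qed (use assms in auto)

lemma val_rev:
  assumes "set js \<subseteq> {1..Suc k}"
  shows "val k (rev js) = inv\<^bsub>G_group k\<^esub> (val k js)"
  using assms
proof (induction js)
  case Nil
  interpret group "G_group k" by (rule group_G)
  show ?case by simp
next
  case (Cons j js)
  interpret group "G_group k" by (rule group_G)
  have j: "val k [j] \<in> carrier (G_group k)" "val k js \<in> carrier (G_group k)"
    using Cons.prems by (auto intro: val_closed)
  have "val k [j] \<otimes>\<^bsub>G_group k\<^esub> val k [j] = \<one>\<^bsub>G_group k\<^esub>"
    using val_append[of "[j]" k "[j]"] val_square[of j k] Cons.prems by simp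
  then have inv: "inv\<^bsub>G_group k\<^esub> (val k [j]) = val k [j]"
    using j by (intro inv_equality) auto
  have "val k (rev (j # js)) = inv\<^bsub>G_group k\<^esub> (val k js) \<otimes>\<^bsub>G_group k\<^esub> val k [j]"
    using Cons val_append[of "rev js" k "[j]"] by simp
  also have "\<dots> = inv\<^bsub>G_group k\<^esub> (val k [j] \<otimes>\<^bsub>G_group k\<^esub> val k js)"
    using j inv by (simp add: inv_mult_group)
  finally show ?case using val_append[of "[j]" k js] Cons.prems by simp
qed

lemma val_letter_inv:
  assumes "j \<in> {1..Suc k}"
  shows "inv\<^bsub>G_group k\<^esub> (val k [j]) = val k [j]"
proof -
  have "val k (rev [j]) = inv\<^bsub>G_group k\<^esub> (val k [j])"
    by (rule val_rev) (use assms in simp)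
  then show ?thesis by (metis rev_singleton_conv)
qed

lemma word_value_G:
  assumes "w \<in> gwords {1..Suc k}"
  shows "word_value (G_group k) (b_gen k) w = val k (map fst w)"
proof -
  interpret group "G_group k" by (rule group_G)
  have "inv\<^bsub>G_group k\<^esub> (b_gen k j) = b_gen k j" "b_gen k j \<in> carrier (G_group k)"
    if "j \<in> {1..Suc k}" for j
  proof -
    have "b_gen k j = val k [j]"
      using that val_eq_class[of "[j]" k]
      by (simp add: b_gen_omit gen_class_def)
    then show "inv\<^bsub>G_group k\<^esub> (b_gen k j) = b_gen k j" "b_gen k j \<in> carrier (G_group k)"
      using val_letter_inv[of j k] val_closed[of "[j]" k] that by simp_all
  qed
  then have "(if e then inv\<^bsub>G_group k\<^esub> (b_gen k j) else b_gen k j) = b_gen k j"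
    if "j \<in> {1..Suc k}" for j e
    using that by simp
  then show ?thesis
    using assms by (induction w) (simp_all add: word_value_def val_def gwords_def case_prod_unfold mem_Times_iff)
qed

lemma word_value_H: "word_value (H_group k) (b_gen k) (map (\<lambda>j. (j, False)) h) = val k h"
  by (induction h) (simp_all add: word_value_def val_def H_group_def)

text \<open>
  Words over sets act through the indices of the sets; both kinds of relators act trivially by
  \<open>act_act\<close> and \<open>fold_act_relator\<close>.
\<close>

lemma val_act:
  assumes "set js \<subseteq> {1..Suc k}" "val k js = \<one>\<^bsub>G_group k\<^esub>" "st \<in> reduced_stacks"
  shows "fold (act k) js st = st"
proof -
  define idx where "idx = the_inv_into {1..Suc k} (omit k)"
  have idx: "idx (omit k j) = j" if "j \<in> {1..Suc k}" for j
    using bij_betw_omit[of k] that by (simp add: idx_def the_inv_into_f_f bij_betw_def)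
  have rel: "(pos_word k js, []) \<in> word_rel (k_subsets k) (G_relators k)"
    using val_eq_iff[of js k "[]"] assms by simp
  have "fold (\<lambda>m. act k (idx m)) (map fst (pos_word k js)) st
      = fold (\<lambda>m. act k (idx m)) (map fst ([] :: nat set gword)) st"
  proof (rule word_rel_fold_eq[where X = reduced_stacks, OF rel])
    fix r st assume r: "r \<in> G_relators k" and st: "st \<in> reduced_stacks"
    show "fold (\<lambda>m. act k (idx m)) (map fst r) st = st"
      using r unfolding G_relators_def
    proof (elim UnE CollectE exE conjE)
      fix m assume "r = [(m, False), (m, False)]"
      then show ?thesis using st by (simp add: act_act)
    next
      fix ms :: "nat set list"
      assume ms: "r = map (\<lambda>m. (m, False)) (ms @ ms)" "distinct ms" "set ms = k_subsets k"
      have "distinct (map idx ms)" "set (map idx ms) = {1..Suc k}"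
        using ms bij_betw_the_inv_into[OF bij_betw_omit[of k]]
        by (simp_all add: distinct_map bij_betw_def idx_def)
      from fold_act_relator[OF this st] show ?thesis
        using ms(1) by (simp add: fold_map o_def)
    qed
  qed (auto intro: act_reduced_stacks simp: act_act assms(3))
  moreover have "fold (\<lambda>m. act k (idx m)) (map fst (pos_word k js)) st = fold (act k) js st"
    using assms(1) idx by (induction js arbitrary: st) auto
  ultimately show ?thesis by simp
qed

text \<open>
  Every letter occurs an even number of times in every relator, so the parity of the number of
  occurrences of a single letter is an invariant.
\<close>

lemma val_1_nontrivial:
  shows "val k [1] \<noteq> \<one>\<^bsub>G_group k\<^esub>"
proof
  define m where "m = omit k 1"
  assume *: "val k [1] = \<one>\<^bsub>G_group k\<^esub>"
  have sub: "set [1] \<subseteq> {1..Suc k}" by simp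
  have nil: "set [] \<subseteq> {1..Suc k}" by simp
  have "val k [1] = val k []" using * by (simp only: val_Nil)
  then have "(pos_word k [1], pos_word k []) \<in> word_rel (k_subsets k) (G_relators k)"
    by (simp only: val_eq_iff[OF sub nil])
  then have rel: "(pos_word k [1], []) \<in> word_rel (k_subsets k) (G_relators k)"
    by (simp only: list.map)
  let ?A = "\<lambda>n b. b \<noteq> (n = m)"
  have fold: "fold ?A ms b \<longleftrightarrow> b \<noteq> odd (count_list ms m)" for ms b
    by (induction ms arbitrary: b) auto
  have "fold ?A (map fst (pos_word k [1])) False = fold ?A (map fst ([] :: nat set gword)) False"
  proof (rule word_rel_fold_eq[where X = UNIV, OF rel])
    fix r b assume "r \<in> G_relators k"
    then have "even (count_list (map fst r) m)"
      by (auto simp: G_relators_def o_def)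
    then show "fold ?A (map fst r) b = b" by (simp only: fold) simp
  qed auto
  then show False by (simp add: m_def)
qed

section \<open>Correctness of the reduction\<close>

text \<open>
  The identity \<open>c T b = Z c T'\<close> behind one step of pushing \<open>c\<close> to the right, in any group with
  an element \<open>C\<close> that satisfies the two inversion laws.
\<close>

lemma (in group) push_identity:
  assumes "C \<in> carrier G" "T \<in> carrier G" "T' \<in> carrier G" "b \<in> carrier G" "V \<in> carrier G"
    and T: "C \<otimes> (T \<otimes> V) = inv (T \<otimes> V) \<otimes> C"
    and T': "C \<otimes> (T' \<otimes> b \<otimes> V) = inv (T' \<otimes> b \<otimes> V) \<otimes> C"
    and b: "inv b = b"
  shows "inv V \<otimes> inv T \<otimes> T' \<otimes> b \<otimes> V \<otimes> C \<otimes> T' = C \<otimes> T \<otimes> b"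
proof -
  let ?w = "T' \<otimes> b \<otimes> V"
  note carr = assms(1-5)
  have cancel: "a \<otimes> (inv a \<otimes> y) = y" if "a \<in> carrier G" "y \<in> carrier G" for a y
    using that by (simp flip: m_assoc)
  have w: "?w \<in> carrier G" using carr by simp
  have "C \<otimes> T' = C \<otimes> ?w \<otimes> inv V \<otimes> inv b"
    using carr by (simp add: m_assoc)
  also have "\<dots> = inv ?w \<otimes> (C \<otimes> (inv V \<otimes> b))"
    unfolding T' b using w carr by (simp add: m_assoc)
  finally have "inv V \<otimes> inv T \<otimes> (?w \<otimes> (C \<otimes> T'))
      = inv V \<otimes> inv T \<otimes> (C \<otimes> (inv V \<otimes> b))"
    using cancel[OF w] carr by simp
  also have "\<dots> = inv (T \<otimes> V) \<otimes> C \<otimes> (inv V \<otimes> b)"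
    using carr by (simp add: inv_mult_group m_assoc)
  also have "\<dots> = C \<otimes> T \<otimes> b"
    unfolding T[symmetric] using carr by (simp add: m_assoc cancel)
  finally show ?thesis using carr by (simp add: m_assoc)
qed

text \<open>
  The relator for the ordering that starts with \<open>c\<close> and continues with \<open>T\<close> reads \<open>c T c T = 1\<close>.
\<close>

lemma val_flip:
  assumes "distinct T" "set T = {1..k}"
  shows "val k [Suc k] \<otimes>\<^bsub>G_group k\<^esub> val k T = inv\<^bsub>G_group k\<^esub> (val k T) \<otimes>\<^bsub>G_group k\<^esub> val k [Suc k]"
proof -
  interpret group "G_group k" by (rule group_G)
  let ?C = "val k [Suc k]"
  have sT: "set (Suc k # T) \<subseteq> {1..Suc k}" "set T \<subseteq> {1..Suc k}" using assms by auto
  have carr: "?C \<in> carrier (G_group k)" "val k T \<in> carrier (G_group k)"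
    using sT by (auto intro: val_closed)
  have CT: "val k (Suc k # T) = ?C \<otimes>\<^bsub>G_group k\<^esub> val k T"
    using val_append[of "[Suc k]" k T] sT by simp
  have "val k ((Suc k # T) @ (Suc k # T)) = \<one>\<^bsub>G_group k\<^esub>"
    by (rule val_permutation_square) (use assms in \<open>auto simp: atLeastAtMostSuc_conv\<close>)
  then have "(?C \<otimes>\<^bsub>G_group k\<^esub> val k T) \<otimes>\<^bsub>G_group k\<^esub> (?C \<otimes>\<^bsub>G_group k\<^esub> val k T) = \<one>\<^bsub>G_group k\<^esub>"
    using val_append[OF sT(1) sT(1)] CT by simp
  then have "?C \<otimes>\<^bsub>G_group k\<^esub> val k T = inv\<^bsub>G_group k\<^esub> (?C \<otimes>\<^bsub>G_group k\<^esub> val k T)"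
    using carr by (intro inv_equality[symmetric]) auto
  also have "\<dots> = inv\<^bsub>G_group k\<^esub> (val k T) \<otimes>\<^bsub>G_group k\<^esub> ?C"
    using carr val_letter_inv[of "Suc k" k] by (simp add: inv_mult_group)
  finally show ?thesis .
qed

lemma set_missing: "set (missing k T) = {1..k} - set T"
  by (auto simp: missing_def)

lemma distinct_missing: "distinct (missing k T)"
  by (simp add: missing_def del: upt_Suc)

lemma count_list_filter_neq:
  "count_list (filter (\<lambda>i. i \<noteq> b) T) i = (if i = b then 0 else count_list T i)"
  by (induction T) auto

lemma letters_mono: "set u \<subseteq> {1..k} \<Longrightarrow> set u \<subseteq> {1..Suc k}"
  by (erule order_trans) simp

text \<open>
  The class of \<open>P\<close> must be trivial for the parity classes to follow the stack: joining
  \<open>conj_word k h\<close> to an entry may not change the class of that entry.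
\<close>

definition push_inv :: "nat \<Rightarrow> nat list \<Rightarrow> nat list \<times> nat list \<Rightarrow> bool" where
  "push_inv k h = (\<lambda>(P, T). set P \<subseteq> {1..k} \<and> set T \<subseteq> {1..k} \<and> distinct T
    \<and> (\<forall>i. odd (count_list T i) = odd (count_list h i))
    \<and> parity_class k P = {} \<and> val k (Suc k # h) = val k (P @ Suc k # T))"

lemma push_inv_step:
  assumes inv: "push_inv k h st" and b: "b \<in> {1..k}" and h: "set h \<subseteq> {1..k}"
  shows "push_inv k (h @ [b]) (push_step k b st)"
proof -
  interpret group "G_group k" by (rule group_G)
  obtain P T where st: "st = (P, T)" by (cases st)
  have PT: "set P \<subseteq> {1..k}" "set T \<subseteq> {1..k}" "distinct T"
      "\<And>i. odd (count_list T i) = odd (count_list h i)"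
      "parity_class k P = {}" "val k (Suc k # h) = val k (P @ Suc k # T)"
    using inv by (auto simp: push_inv_def st)
  have "val k (Suc k # h @ [b]) = val k (Suc k # h) \<otimes>\<^bsub>G_group k\<^esub> val k [b]"
    using val_append[of "Suc k # h" k "[b]"] b h by (auto simp: subset_iff le_Suc_eq)
  also have "\<dots> = val k (P @ Suc k # T @ [b])"
    using val_append[of "P @ Suc k # T" k "[b]"] b PT by (auto simp: subset_iff le_Suc_eq)
  finally have step: "val k (Suc k # h @ [b]) = val k (P @ Suc k # T @ [b])" .
  show ?thesis
  proof (cases "b \<in> set T")
    case False
    then show ?thesis
      using PT b step by (auto simp: push_inv_def push_step_def st)
  next
    case True
    define V where "V = missing k T"
    define T' where "T' = filter (\<lambda>i. i \<noteq> b) T"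
    define Z where "Z = rev V @ rev T @ T' @ b # V"
    have V: "set V = {1..k} - set T" "distinct V"
      by (simp_all add: V_def set_missing distinct_missing)
    have T': "set T' = set T - {b}" "distinct T'"
      using PT(3) by (auto simp: T'_def)
    have cT: "count_list T b = 1" using True PT(3) by (simp add: count_list_distinct)
    have count: "odd (count_list T' i) = odd (count_list (h @ [b]) i)" for i
      using PT(4)[of i] cT by (auto simp: T'_def count_list_filter_neq)
    have "even (count_list Z i)" for i
      using cT by (auto simp: Z_def T'_def count_list_filter_neq)
    then have Z: "parity_class k Z = {}"
      by (auto simp: parity_class_def)
    have small: "set V \<subseteq> {1..k}" "set T' \<subseteq> {1..k}" "set [b] \<subseteq> {1..k}"
      using PT(2) V(1) T'(1) b by auto
    have sub: "set V \<subseteq> {1..Suc k}" "set T \<subseteq> {1..Suc k}" "set T' \<subseteq> {1..Suc k}"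
        "set P \<subseteq> {1..Suc k}" "set [b] \<subseteq> {1..Suc k}" "set [Suc k] \<subseteq> {1..Suc k}"
      using small PT(1,2) by (simp_all add: letters_mono)
    note carr = val_closed[OF sub(1)] val_closed[OF sub(2)] val_closed[OF sub(3)]
      val_closed[OF sub(4)] val_closed[OF sub(5)] val_closed[OF sub(6)]
    have app: "val k (x # u) = val k [x] \<otimes>\<^bsub>G_group k\<^esub> val k u"
      if "x \<in> {1..Suc k}" "set u \<subseteq> {1..Suc k}" for x u
      using val_append[of "[x]" k u] that by simp
    have "val k [Suc k] \<otimes>\<^bsub>G_group k\<^esub> val k (T @ V)
        = inv\<^bsub>G_group k\<^esub> (val k (T @ V)) \<otimes>\<^bsub>G_group k\<^esub> val k [Suc k]"
      by (rule val_flip) (use PT V in auto)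
    moreover have "val k [Suc k] \<otimes>\<^bsub>G_group k\<^esub> val k (T' @ [b] @ V)
        = inv\<^bsub>G_group k\<^esub> (val k (T' @ [b] @ V)) \<otimes>\<^bsub>G_group k\<^esub> val k [Suc k]"
      by (rule val_flip) (use PT V T' True in auto)
    moreover have "val k (T @ V) = val k T \<otimes>\<^bsub>G_group k\<^esub> val k V"
      using sub by (simp add: val_append)
    moreover have "val k (T' @ [b] @ V)
        = val k T' \<otimes>\<^bsub>G_group k\<^esub> val k [b] \<otimes>\<^bsub>G_group k\<^esub> val k V"
      using sub carr by (simp add: val_append app[of b V] m_assoc)
    moreover have "inv\<^bsub>G_group k\<^esub> (val k [b]) = val k [b]"
      by (rule val_letter_inv) (use b in simp)
    ultimately have "inv\<^bsub>G_group k\<^esub> (val k V) \<otimes>\<^bsub>G_group k\<^esub> inv\<^bsub>G_group k\<^esub> (val k T)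
        \<otimes>\<^bsub>G_group k\<^esub> val k T' \<otimes>\<^bsub>G_group k\<^esub> val k [b] \<otimes>\<^bsub>G_group k\<^esub> val k V
        \<otimes>\<^bsub>G_group k\<^esub> val k [Suc k] \<otimes>\<^bsub>G_group k\<^esub> val k T'
        = val k [Suc k] \<otimes>\<^bsub>G_group k\<^esub> val k T \<otimes>\<^bsub>G_group k\<^esub> val k [b]"
      using carr by (intro push_identity) auto
    then have "val k (P @ Z @ Suc k # T') = val k (P @ Suc k # T @ [b])"
      using sub carr
      by (simp add: Z_def val_append app[of b "V @ Suc k # T'"] app[of "Suc k" T']
          app[of "Suc k" "T @ [b]"] val_rev m_assoc)
    then have "val k (Suc k # h @ [b]) = val k ((P @ Z) @ Suc k # T')"
      using step by simp
    moreover have "push_step k b st = (P @ Z, T')"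
      using True by (simp add: push_step_def st Z_def V_def T'_def)
    moreover have "set Z \<subseteq> {1..k}" "set T' \<subseteq> {1..k}"
      using PT V T' b by (auto simp: Z_def)
    ultimately show ?thesis
      using PT T' Z count parity_class_append[of k P Z] by (simp add: push_inv_def)
  qed
qed

lemma push_inv_push: "set h \<subseteq> {1..k} \<Longrightarrow> push_inv k h (push k h)"
proof (induction h rule: rev_induct)
  case Nil
  show ?case by (simp add: push_inv_def push_def parity_class_def)
next
  case (snoc b h)
  then show ?case using push_inv_step[of k h "push k h" b] by (simp add: push_def)
qed

lemma balanced_cases:
  assumes "set h \<subseteq> {1..k}"
  obtains P T where "push_inv k h (P, T)" "conj_word k h = P @ rev T"
    "balanced k h \<longleftrightarrow> set T = {} \<or> set T = {1..k}"
proof (rule that[of "fst (push k h)" "snd (push k h)"])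
  show "push_inv k h (fst (push k h), snd (push k h))"
    using push_inv_push[OF assms] by simp
  then have "set (snd (push k h)) \<subseteq> {1..k}" by (simp add: push_inv_def case_prod_unfold)
  then show "balanced k h \<longleftrightarrow> set (snd (push k h)) = {} \<or> set (snd (push k h)) = {1..k}"
    using set_missing[of k "snd (push k h)"] by (auto simp: balanced_def simp flip: set_empty)
qed (simp add: conj_word_def)

lemma agree_everywhere_iff:
  assumes "A \<subseteq> B" "x \<in> B"
  shows "{i \<in> B. (i \<in> A) \<noteq> (x \<in> A)} = {} \<longleftrightarrow> A = {} \<or> A = B"
  using assms by (cases "x \<in> A") auto

text \<open>
  The list \<open>T\<close> consists of the letters with odd multiplicity in \<open>h\<close>; these are none or all
  exactly if all the multiplicities have the parity of that of the letter 1.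
\<close>

lemma balanced_iff:
  assumes "set h \<subseteq> {1..k}" "k \<ge> 1"
  shows "balanced k h \<longleftrightarrow> parity_class k h = {}"
proof -
  obtain P T where inv: "push_inv k h (P, T)"
    and bal: "balanced k h \<longleftrightarrow> set T = {} \<or> set T = {1..k}"
    by (rule balanced_cases[OF assms(1)])
  have T: "set T \<subseteq> {1..k}" "distinct T" "\<And>i. odd (count_list T i) = odd (count_list h i)"
    using inv by (simp_all add: push_inv_def)
  have odd: "i \<in> set T \<longleftrightarrow> odd (count_list h i)" for i
    unfolding T(3)[symmetric] count_list_distinct[OF T(2)] by simp
  have one: "1 \<in> {1..k}" using assms(2) by simp
  have "parity_class k h = {i \<in> {1..k}. (i \<in> set T) \<noteq> (1 \<in> set T)}"
    unfolding parity_class_def odd ..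
  also have "\<dots> = {} \<longleftrightarrow> set T = {} \<or> set T = {1..k}"
    by (rule agree_everywhere_iff[OF T(1) one])
  finally show ?thesis unfolding bal by (rule HOL.sym)
qed

lemma conj_word_letters: "set h \<subseteq> {1..k} \<Longrightarrow> set (conj_word k h) \<subseteq> {1..k}"
  by (erule balanced_cases) (simp add: push_inv_def)

lemma parity_class_conj_word:
  assumes "set h \<subseteq> {1..k}" "balanced k h"
  shows "parity_class k (conj_word k h) = {}"
proof -
  obtain P T where inv: "push_inv k h (P, T)" and c: "conj_word k h = P @ rev T"
    and bal: "balanced k h \<longleftrightarrow> set T = {} \<or> set T = {1..k}"
    by (rule balanced_cases[OF assms(1)])
  have T: "set T = {} \<or> set T = {1..k}" using bal assms(2) by simp
  have "parity_class k T = {}"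
    using T inv parity_class_permutation[of T k] by (auto simp: push_inv_def parity_class_def)
  then show ?thesis
    using inv c by (simp add: parity_class_append push_inv_def)
qed

lemma val_conj_word:
  assumes "set h \<subseteq> {1..k}" "balanced k h"
  shows "val k (Suc k # h @ [Suc k]) = val k (conj_word k h)"
proof -
  interpret group "G_group k" by (rule group_G)
  obtain P T where inv: "push_inv k h (P, T)" and c: "conj_word k h = P @ rev T"
    and bal: "balanced k h \<longleftrightarrow> set T = {} \<or> set T = {1..k}"
    by (rule balanced_cases[OF assms(1)])
  have T: "set T = {} \<or> set T = {1..k}" using bal assms(2) by simp
  have sub: "set P \<subseteq> {1..Suc k}" "set T \<subseteq> {1..Suc k}" "set h \<subseteq> {1..Suc k}"
    using inv assms(1) by (auto simp: push_inv_def)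
  have C: "set [Suc k] \<subseteq> {1..Suc k}" by simp
  note carr = val_closed[OF sub(1)] val_closed[OF sub(2)] val_closed[OF C]
  have CC: "val k [Suc k] \<otimes>\<^bsub>G_group k\<^esub> val k [Suc k] = \<one>\<^bsub>G_group k\<^esub>"
    using val_append[OF C C] val_square[of "Suc k" k] by simp
  have flip: "val k [Suc k] \<otimes>\<^bsub>G_group k\<^esub> val k T
      = inv\<^bsub>G_group k\<^esub> (val k T) \<otimes>\<^bsub>G_group k\<^esub> val k [Suc k]"
    using T
  proof
    assume "set T = {}"
    then show ?thesis using carr by simp
  next
    assume "set T = {1..k}"
    then show ?thesis using inv by (intro val_flip) (auto simp: push_inv_def)
  qed
  have "val k (Suc k # h @ [Suc k]) = val k (P @ Suc k # T) \<otimes>\<^bsub>G_group k\<^esub> val k [Suc k]"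
    using inv val_append[of "Suc k # h" k "[Suc k]"] sub by (simp add: push_inv_def)
  also have "val k (P @ Suc k # T) = val k P \<otimes>\<^bsub>G_group k\<^esub> (val k [Suc k] \<otimes>\<^bsub>G_group k\<^esub> val k T)"
    using val_append[of P k "Suc k # T"] val_append[of "[Suc k]" k T] sub by simp
  also have "\<dots> \<otimes>\<^bsub>G_group k\<^esub> val k [Suc k] = val k P \<otimes>\<^bsub>G_group k\<^esub> inv\<^bsub>G_group k\<^esub> (val k T)"
    using carr by (simp add: flip m_assoc CC)
  also have "\<dots> = val k (conj_word k h)"
    using sub by (simp add: c val_append val_rev)
  finally show ?thesis .
qed

fun flatten :: "nat \<Rightarrow> nat list list \<Rightarrow> nat list" where
  "flatten k [] = []"
| "flatten k [h] = h"
| "flatten k (h # s) = flatten k s @ Suc k # h"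

abbreviation H_stacks :: "nat \<Rightarrow> nat list list set" where
  "H_stacks k \<equiv> {st. st \<noteq> [] \<and> (\<forall>h\<in>set st. set h \<subseteq> {1..k})}"

lemma flatten_letters: "st \<in> H_stacks k \<Longrightarrow> set (flatten k st) \<subseteq> {1..Suc k}"
  by (induction k st rule: flatten.induct) (simp_all add: letters_mono)

lemma stack_step_H_stacks:
  assumes "st \<in> H_stacks k" "j \<in> {1..Suc k}"
  shows "stack_step k j st \<in> H_stacks k"
proof -
  obtain h s where st: "st = h # s" using assms(1) by (cases st) auto
  have "set (conj_word k h) \<subseteq> {1..k}"
    by (rule conj_word_letters) (use assms(1) in \<open>simp add: st\<close>)
  then show ?thesis
    using assms by (cases s) (simp_all add: st stack_step_def)
qed

lemma val_stack_step:
  assumes "st \<in> H_stacks k" "j \<in> {1..Suc k}"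
  shows "val k (flatten k (stack_step k j st)) = val k (flatten k st @ [j])"
proof -
  obtain h s where st: "st = h # s" using assms(1) by (cases st) auto
  show ?thesis
  proof (cases "j = Suc k \<and> s \<noteq> [] \<and> balanced k h")
    case False
    then show ?thesis
      by (cases s) (auto simp: st stack_step_def)
  next
    case True
    then obtain h' s' where s: "s = h' # s'" by (cases s) auto
    have h: "set h \<subseteq> {1..k}" "set h' \<subseteq> {1..k}" and s': "h' # s' \<in> H_stacks k"
      using assms(1) by (auto simp: st s)
    have fl: "set (flatten k (h' # s')) \<subseteq> {1..Suc k}" by (rule flatten_letters[OF s'])
    have ap: "flatten k ((h' @ x) # s') = flatten k (h' # s') @ x" for x
      by (cases s') auto
    have "val k (flatten k st @ [j])
        = val k (flatten k (h' # s')) \<otimes>\<^bsub>G_group k\<^esub> val k (Suc k # h @ [Suc k])"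
      using val_append[OF fl, of "Suc k # h @ [Suc k]"] h True by (simp add: st s letters_mono)
    also have "\<dots> = val k (flatten k (h' # s')) \<otimes>\<^bsub>G_group k\<^esub> val k (conj_word k h)"
      using val_conj_word[OF h(1)] True by simp
    also have "\<dots> = val k (flatten k (h' # s') @ conj_word k h)"
      using val_append[OF fl letters_mono[OF conj_word_letters[OF h(1)]]] by simp
    finally show ?thesis using True by (simp add: st s stack_step_def ap)
  qed
qed

text \<open>
  Taking parity classes turns the algorithm into the action, because the test \<open>balanced\<close>
  depends on the parity class only and replacements have the trivial class.
\<close>

lemma parity_stack_step:
  assumes "st \<in> H_stacks k" "k \<ge> 1"
  shows "map (parity_class k) (stack_step k j st) = act k j (map (parity_class k) st)"
proof -
  obtain h s where st: "st = h # s" using assms(1) by (cases st) auto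
  have h: "set h \<subseteq> {1..k}" using assms(1) by (simp add: st)
  have nil: "parity_class k [] = {}" by (simp add: parity_class_def)
  show ?thesis
  proof (cases "j = Suc k \<and> s \<noteq> []")
    case False
    show ?thesis
    proof (cases "j = Suc k")
      case True
      then have "s = []" using False by simp
      then show ?thesis using True by (simp add: st stack_step_def act_def nil)
    next
      case False
      then show ?thesis by (simp add: st stack_step_def act_def parity_class_append)
    qed
  next
    case True
    then obtain h' s' where s: "s = h' # s'" by (cases s) auto
    have j: "j = Suc k" using True by simp
    show ?thesis
    proof (cases "balanced k h")
      case True
      have "parity_class k h = {}"
        using True balanced_iff[OF h assms(2)] by simp
      then have "act k j (map (parity_class k) st) = map (parity_class k) s"
        by (simp add: st s act_def j)
      moreover have "stack_step k j st = (h' @ conj_word k h) # s'"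
        using True by (simp add: st s stack_step_def j)
      moreover have "parity_class k (h' @ conj_word k h) = parity_class k h'"
        using parity_class_conj_word[OF h True] by (simp add: parity_class_append)
      ultimately show ?thesis by (simp only: list.map s)
    next
      case False
      then have "parity_class k h \<noteq> {}" using balanced_iff[OF h assms(2)] by simp
      then have "act k j (map (parity_class k) st) = {} # map (parity_class k) st"
        by (simp add: st s act_def j)
      moreover have "stack_step k j st = [] # st"
        using False by (simp add: st s stack_step_def j)
      ultimately show ?thesis by (simp only: list.map nil)
    qed
  qed
qed

lemma stack_correct:
  assumes "set js \<subseteq> {1..Suc k}" "k \<ge> 1"
  shows "stack k js \<in> H_stacks k
    \<and> val k (flatten k (stack k js)) = val k js
    \<and> map (parity_class k) (stack k js) = fold (act k) js [{}]"
  using assms(1)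
proof (induction js rule: rev_induct)
  case Nil
  have "stack k [] = [[]]" by (simp add: stack_def)
  moreover have "parity_class k [] = {}" by (simp add: parity_class_def)
  ultimately show ?case by simp
next
  case (snoc j js)
  let ?st = "stack k js"
  have j: "j \<in> {1..Suc k}" "set [j] \<subseteq> {1..Suc k}" and js: "set js \<subseteq> {1..Suc k}"
    using snoc.prems by simp_all
  note IH = snoc.IH[OF js, THEN conjunct1] snoc.IH[OF js, THEN conjunct2, THEN conjunct1]
    snoc.IH[OF js, THEN conjunct2, THEN conjunct2]
  have eq: "stack k (js @ [j]) = stack_step k j ?st" by (simp add: stack_def)
  have "val k (flatten k (stack_step k j ?st)) = val k (flatten k ?st) \<otimes>\<^bsub>G_group k\<^esub> val k [j]"
    unfolding val_stack_step[OF IH(1) j(1)] by (rule val_append[OF flatten_letters[OF IH(1)] j(2)])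
  also have "\<dots> = val k (js @ [j])"
    unfolding IH(2) val_append[OF js j(2)] ..
  finally have "val k (flatten k (stack_step k j ?st)) = val k (js @ [j])" .
  moreover have "map (parity_class k) (stack_step k j ?st) = fold (act k) (js @ [j]) [{}]"
    unfolding parity_stack_step[OF IH(1) assms(2)] IH(3) by simp
  ultimately show ?case
    unfolding eq by (intro conjI stack_step_H_stacks[OF IH(1) j(1)])
qed

text \<open>
  The value of the input word is preserved as long as one entry is left at the end. Otherwise
  the action moves the stack \<open>[{}]\<close> to a stack of another length, so that the input word
  is not trivial.
\<close>

lemma reduce_correct:
  assumes "w \<in> gwords {1..Suc k}" "k \<ge> 1"
  shows "reduce k w \<in> gwords {1..k}"
    and "word_value (H_group k) (b_gen k) (reduce k w) = \<one>\<^bsub>H_group k\<^esub>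
      \<longleftrightarrow> word_value (G_group k) (b_gen k) w = \<one>\<^bsub>G_group k\<^esub>"
proof -
  let ?js = "map fst w"
  have js: "set ?js \<subseteq> {1..Suc k}" using assms(1) by (auto simp: gwords_def)
  note correct = stack_correct[OF js assms(2)]
  note st = correct[THEN conjunct1] correct[THEN conjunct2, THEN conjunct1]
    correct[THEN conjunct2, THEN conjunct2]
  obtain h s where hs: "stack k ?js = h # s" using st(1) by (cases "stack k ?js") auto
  have h: "set h \<subseteq> {1..k}" using st(1) by (simp add: hs)
  show "reduce k w \<in> gwords {1..k}"
    using h assms(2) by (auto simp: reduce_def hs gwords_def)
  have one: "\<one>\<^bsub>H_group k\<^esub> = \<one>\<^bsub>G_group k\<^esub>" by (simp add: H_group_def)
  show "word_value (H_group k) (b_gen k) (reduce k w) = \<one>\<^bsub>H_group k\<^esub>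
      \<longleftrightarrow> word_value (G_group k) (b_gen k) w = \<one>\<^bsub>G_group k\<^esub>"
  proof (cases "s = []")
    case True
    then show ?thesis
      using st(2) by (simp add: hs reduce_def word_value_H word_value_G[OF assms(1)] one)
  next
    case False
    have "fold (act k) ?js [{}] \<noteq> [{}]"
    proof
      assume "fold (act k) ?js [{}] = [{}]"
      then have "map (parity_class k) (h # s) = [{}]" using st(3) by (simp only: hs)
      then show False using False by simp
    qed
    then have "val k ?js \<noteq> \<one>\<^bsub>G_group k\<^esub>"
      using val_act[OF js, of "[{}]"] by (auto simp: reduced_stacks_def)
    moreover have "reduce k w = map (\<lambda>j. (j, False)) [1]"
      using False by (simp add: reduce_def hs)
    then have "word_value (H_group k) (b_gen k) (reduce k w) = val k [1]"
      by (simp only: word_value_H)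
    ultimately show ?thesis
      unfolding one word_value_G[OF assms(1)] using val_1_nontrivial[of k] by metis
  qed
qed

text \<open>
  The single program \<open>t\<close> that transforms solutions also gives solvability for each fixed \<open>k\<close>.
\<close>

theorem theorem5:
  shows "(\<forall>k\<ge>1. word_problem_solvable (H_group k) (b_gen k) k
            \<longrightarrow> word_problem_solvable (G_group k) (b_gen k) (k + 1))
    \<and> (\<exists>t. \<forall>k\<ge>1. \<forall>p. solves_word_problem p (H_group k) (b_gen k) k
            \<longrightarrow> (\<exists>q. computes t [k, recf_code p] (recf_code q)
                   \<and> solves_word_problem q (G_group k) (b_gen k) (k + 1)))"
proof -
  obtain q t where t: "\<And>k p. computes t [k, recf_code p] (recf_code (q k p))"
    and q: "\<And>k p w z. computes p [enc (reduce k w)] z \<Longrightarrow> computes (q k p) [enc w] z"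
    by (rule uniform_reduction[where f = reduce, OF computable_reduce]) (rule that)
  have "solves_word_problem (q k p) (G_group k) (b_gen k) (k + 1)"
    if "k \<ge> 1" "solves_word_problem p (H_group k) (b_gen k) k" for k p
    unfolding solves_word_problem_def
  proof
    fix w assume "w \<in> gwords {1..k + 1}"
    then have w: "w \<in> gwords {1..Suc k}" by (simp flip: Suc_eq_plus1)
    have "computes p [gword_code (reduce k w)]
        (if word_value (H_group k) (b_gen k) (reduce k w) = \<one>\<^bsub>H_group k\<^esub> then 1 else 0)"
      using that(2) reduce_correct(1)[OF w that(1)] unfolding solves_word_problem_def by blast
    then show "computes (q k p) [gword_code w]
        (if word_value (G_group k) (b_gen k) w = \<one>\<^bsub>G_group k\<^esub> then 1 else 0)"
      unfolding reduce_correct(2)[OF w that(1)] gword_code_eq_enc by (rule q)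
  qed
  then show ?thesis
    using t unfolding word_problem_solvable_def by blast
qed

end
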